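(* Let $E$ and $F$ be Banach lattices and let $S, T: E \to F$ be positive operators such that $S \leq T$ and $T$ is an almost limited completely continuous operator. If $E$ is $\sigma$-Dedekind complete and $F$ has order continuous norm, then $S$ is an almost limited completely continuous operator.
   Context: All Banach spaces and Banach lattices are real; operators are linear. $E'$ denotes the topological dual of $E$, a Banach lattice with the dual order. A sequence $(f_n)$ in a Banach lattice is disjoint if $|f_n| \wedge |f_m| = 0$ for $n \neq m$. A bounded set $A \subset E$ is almost limited if every disjoint weak* null sequence $(f_n)$ in $E'$ converges uniformly to zero on $A$, i.e. $\sup_{x \in A} |f_n(x)| \to 0$. A sequence $(x_n)$ in $E$ is almost limited if the set $\{x_n : n \in \mathbb{N}\}$ is almost limited. A bounded linear operator $T: E \to Y$ into a Banach space $Y$ is almost limited completely continuous (alcc) if $\|Tx_n\| \to 0$ for every almost limited weakly null sequence $(x_n) \subset E$. $E$ is $\sigma$-Dedekind complete if every nonempty countable subset of $E$ that is bounded above has a supremum. The norm of $F$ is order continuous if $\|x_\alpha\| \to 0$ for every decreasing net $(x_\alpha)$ in $F$ with infimum $0$. $S \le T$ means that $T - S$ is a positive operator. *)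

theory Defs
  imports "HOL-Analysis.Analysis" "HOL-Library.Lattice_Algebras" "HOL-Library.Lub_Glb"
begin

section \<open>Banach lattices\<close>

class banach_lattice = banach + ordered_real_vector + lattice_ab_group_add_abs +
  assumes norm_mono_abs: "\<bar>x\<bar> \<le> \<bar>y\<bar> \<Longrightarrow> norm x \<le> norm y"

instance real :: banach_lattice
  by standard simp

definition sigma_dedekind_complete :: "'a::order itself \<Rightarrow> bool" where
  "sigma_dedekind_complete _ \<longleftrightarrow>
     (\<forall>A :: 'a set. A \<noteq> {} \<and> countable A \<and> bdd_above A \<longrightarrow> (\<exists>s. isLub UNIV A s))"


section \<open>Nets and order continuity of the norm\<close>

definition directed_by :: "'i set \<Rightarrow> ('i \<Rightarrow> 'i \<Rightarrow> bool) \<Rightarrow> bool" where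
  "directed_by I r \<longleftrightarrow> I \<noteq> {} \<and> (\<forall>i\<in>I. r i i) \<and>
     (\<forall>i\<in>I. \<forall>j\<in>I. \<forall>k\<in>I. r i j \<longrightarrow> r j k \<longrightarrow> r i k) \<and>
     (\<forall>i\<in>I. \<forall>j\<in>I. \<exists>k\<in>I. r i k \<and> r j k)"

definition net_filter :: "'i set \<Rightarrow> ('i \<Rightarrow> 'i \<Rightarrow> bool) \<Rightarrow> 'i filter" where
  "net_filter I r = (INF i\<in>I. principal {j\<in>I. r i j})"

lemma eventually_net_filter:
  assumes "directed_by I r"
  shows "eventually P (net_filter I r) \<longleftrightarrow> (\<exists>i\<in>I. \<forall>j\<in>I. r i j \<longrightarrow> P j)"
  unfolding net_filter_def
proof (subst eventually_INF_base)
  show "I \<noteq> {}" using assms by (simp add: directed_by_def)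
next
  fix a b assume "a \<in> I" "b \<in> I"
  then obtain k where k: "k \<in> I" "r a k" "r b k"
    using assms unfolding directed_by_def by blast
  have "{j \<in> I. r k j} \<subseteq> {j \<in> I. r a j} \<inter> {j \<in> I. r b j}"
    using assms k \<open>a \<in> I\<close> \<open>b \<in> I\<close> unfolding directed_by_def by blast
  then show "\<exists>x\<in>I. principal {j \<in> I. r x j} \<le>
      inf (principal {j \<in> I. r a j}) (principal {j \<in> I. r b j})"
    using k(1) by auto
qed (auto simp: eventually_principal)

text \<open>
  The index sets are taken inside the space itself, since a definition cannot quantify over types.
  This loses no generality (lemma \<open>order_continuous_norm_any_index\<close>): a decreasing net with an
  arbitrary index set can be re-indexed by its range with the reversed order.
\<close>

definition order_continuous_norm :: "'a::banach_lattice itself \<Rightarrow> bool" where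
  "order_continuous_norm _ \<longleftrightarrow>
     (\<forall>(I :: 'a set) r (x :: 'a \<Rightarrow> 'a).
        directed_by I r \<and> (\<forall>i\<in>I. \<forall>j\<in>I. r i j \<longrightarrow> x j \<le> x i) \<and> isGlb UNIV (x ` I) 0 \<longrightarrow>
        ((\<lambda>i. norm (x i)) \<longlongrightarrow> 0) (net_filter I r))"

lemma order_continuous_norm_any_index:
  fixes I :: "'i set" and x :: "'i \<Rightarrow> 'a::banach_lattice"
  assumes "order_continuous_norm TYPE('a)"
    and dir: "directed_by I r" and dec: "\<And>i j. i \<in> I \<Longrightarrow> j \<in> I \<Longrightarrow> r i j \<Longrightarrow> x j \<le> x i"
    and glb: "isGlb UNIV (x ` I) 0"
  shows "((\<lambda>i. norm (x i)) \<longlongrightarrow> 0) (net_filter I r)"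
proof -
  let ?D = "x ` I" and ?R = "\<lambda>a b :: 'a. b \<le> a"
  have dirD: "directed_by ?D ?R"
    unfolding directed_by_def
  proof (intro conjI)
    show "\<forall>i\<in>?D. \<forall>j\<in>?D. \<exists>k\<in>?D. k \<le> i \<and> k \<le> j"
    proof clarify
      fix i j assume ij: "i \<in> I" "j \<in> I"
      then obtain k where "k \<in> I" "r i k" "r j k"
        using dir unfolding directed_by_def by blast
      then show "\<exists>k\<in>?D. k \<le> x i \<and> k \<le> x j" using dec ij by blast
    qed
    show "?D \<noteq> {}" using dir by (simp add: directed_by_def)
  qed (blast intro: order_trans)+
  have "((\<lambda>a. norm ((\<lambda>a. a) a)) \<longlongrightarrow> 0) (net_filter ?D ?R)"
    using assms(1)[unfolded order_continuous_norm_def, rule_format, of ?D ?R "\<lambda>a. a"]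
      dirD glb by simp
  then have D: "\<exists>i\<in>I. \<forall>j\<in>I. x j \<le> x i \<longrightarrow> norm (x j) < e" if "e > 0" for e
    using that by (simp add: tendsto_iff eventually_net_filter[OF dirD])
  show ?thesis
    unfolding tendsto_iff eventually_net_filter[OF dir]
  proof (intro allI impI)
    fix e :: real assume "0 < e"
    then obtain i where "i \<in> I" "\<forall>j\<in>I. x j \<le> x i \<longrightarrow> norm (x j) < e" using D by blast
    then have "i \<in> I \<and> (\<forall>j\<in>I. r i j \<longrightarrow> dist (norm (x j)) 0 < e)" using dec by simp
    then show "\<exists>i\<in>I. \<forall>j\<in>I. r i j \<longrightarrow> dist (norm (x j)) 0 < e" by blast
  qed
qed


section \<open>The dual order\<close>

text \<open>
  The topological dual of \<open>'a\<close> is \<open>'a \<Rightarrow>\<^sub>L real\<close>.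
\<close>

instantiation blinfun :: (banach_lattice, "{real_normed_vector, order}") order
begin

definition less_eq_blinfun :: "('a \<Rightarrow>\<^sub>L 'b) \<Rightarrow> ('a \<Rightarrow>\<^sub>L 'b) \<Rightarrow> bool" where
  "less_eq_blinfun f g \<longleftrightarrow> (\<forall>x\<ge>0. blinfun_apply f x \<le> blinfun_apply g x)"

definition less_blinfun :: "('a \<Rightarrow>\<^sub>L 'b) \<Rightarrow> ('a \<Rightarrow>\<^sub>L 'b) \<Rightarrow> bool" where
  "less_blinfun f g \<longleftrightarrow> f \<le> g \<and> \<not> g \<le> f"

instance
proof
  fix f g h :: "'a \<Rightarrow>\<^sub>L 'b"
  show "f < g \<longleftrightarrow> f \<le> g \<and> \<not> g \<le> f" by (rule less_blinfun_def)
  show "f \<le> f" by (simp add: less_eq_blinfun_def)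
  show "f \<le> g \<Longrightarrow> g \<le> h \<Longrightarrow> f \<le> h"
    unfolding less_eq_blinfun_def by (meson order_trans)
  assume fg: "f \<le> g" "g \<le> f"
  show "f = g"
  proof (rule blinfun_eqI)
    fix x :: 'a
    have eq: "blinfun_apply f y = blinfun_apply g y" if "0 \<le> y" for y :: 'a
      using fg that by (auto simp: less_eq_blinfun_def intro: antisym)
    have "x = pprt x - pprt (- x)" by (simp add: pprt_neg flip: prts)
    then show "blinfun_apply f x = blinfun_apply g x"
      by (metis blinfun.diff_right eq zero_le_pprt)
  qed
qed

end

text \<open>
  Disjointness in the dual, i.e. \<open>\<bar>f\<bar> \<sqinter> \<bar>g\<bar> = 0\<close>. Since \<open>'a \<Rightarrow>\<^sub>L 'b\<close> need not be a lattice for a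
  general \<open>'b\<close>, it carries no lattice operations here; they are spelled out as suprema and infima
  in the dual order, with \<open>u = \<bar>f\<bar> = f \<squnion> (- f)\<close> and \<open>v = \<bar>g\<bar> = g \<squnion> (- g)\<close>. The lemmas
  \<open>ex_dual_sup\<close> and \<open>ex_dual_inf\<close> below show that these always exist.
\<close>

definition dual_disjoint :: "('a::banach_lattice \<Rightarrow>\<^sub>L real) \<Rightarrow> ('a \<Rightarrow>\<^sub>L real) \<Rightarrow> bool" where
  "dual_disjoint f g \<longleftrightarrow>
     (\<exists>u v. isLub UNIV {f, - f} u \<and> isLub UNIV {g, - g} v \<and> isGlb UNIV {u, v} 0)"

lemma norm_mono_nonneg:
  fixes x y :: "'a::banach_lattice"
  assumes "0 \<le> x" "x \<le> y" shows "norm x \<le> norm y"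
  using assms by (intro norm_mono_abs) (simp add: abs_of_nonneg)

lemma norm_pprt_le: "norm (pprt x) \<le> norm (x :: 'a::banach_lattice)"
  by (rule norm_mono_abs) (simp add: pprt_def abs_of_nonneg abs_ge_self)

lemma pprt_decomp: "(x :: 'a::lattice_ab_group_add) = pprt x - pprt (- x)"
  by (simp add: pprt_neg flip: prts)

lemma ex_dual_pos_part:
  fixes h :: "'a::banach_lattice \<Rightarrow>\<^sub>L real"
  shows "\<exists>u. 0 \<le> u \<and> h \<le> u \<and> (\<forall>w. 0 \<le> w \<longrightarrow> h \<le> w \<longrightarrow> u \<le> w)"
proof -
  define p where "p x = Sup (blinfun_apply h ` {y. 0 \<le> y \<and> y \<le> x})" for x :: 'a
  have bnd: "blinfun_apply h y \<le> norm h * norm x" if "0 \<le> y" "y \<le> x" for x y :: 'a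
  proof -
    have "blinfun_apply h y \<le> norm h * norm y"
      using norm_blinfun[of h y] by simp
    also have "\<dots> \<le> norm h * norm x"
      by (intro mult_left_mono norm_mono_nonneg that) simp
    finally show ?thesis .
  qed
  have upper: "blinfun_apply h y \<le> p x" if "0 \<le> y" "y \<le> x" for x y :: 'a
    unfolding p_def by (rule cSup_upper) (use that bnd in \<open>auto intro!: bdd_aboveI2\<close>)
  have least: "p x \<le> c" if "0 \<le> x" "\<And>y. 0 \<le> y \<Longrightarrow> y \<le> x \<Longrightarrow> blinfun_apply h y \<le> c" for x c
    unfolding p_def by (rule cSup_least) (use that in auto)
  have p_nonneg: "0 \<le> p x" if "0 \<le> x" for x
    using upper[of 0 x] that by (simp add: blinfun.zero_right)
  have p_le: "p x \<le> norm h * norm x" if "0 \<le> x" for x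
    using least bnd that by blast
  have p_add: "p (x + y) = p x + p y" if xy: "0 \<le> x" "0 \<le> y" for x y
  proof (rule antisym)
    show "p (x + y) \<le> p x + p y"
    proof (rule least)
      fix z assume z: "0 \<le> z" "z \<le> x + y"
      have "z - inf z x = sup 0 (z - x)"
        by (simp add: add_sup_distrib_left)
      also have "\<dots> \<le> y" using z xy by (simp add: algebra_simps)
      finally have "z - inf z x \<le> y" .
      then have "blinfun_apply h (inf z x) + blinfun_apply h (z - inf z x) \<le> p x + p y"
        using z xy by (intro add_mono upper) (auto simp del: diff_inf_eq_sup)
      then show "blinfun_apply h z \<le> p x + p y"
        by (simp flip: blinfun.add_right del: diff_inf_eq_sup)
    qed (use xy in simp)
    have "blinfun_apply h a \<le> p (x + y) - p y" if a: "0 \<le> a" "a \<le> x" for a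
    proof -
      have "p y \<le> p (x + y) - blinfun_apply h a"
      proof (rule least)
        fix b assume "0 \<le> b" "b \<le> y"
        then have "blinfun_apply h (a + b) \<le> p (x + y)"
          using a by (intro upper add_nonneg_nonneg add_mono)
        then show "blinfun_apply h b \<le> p (x + y) - blinfun_apply h a"
          by (simp add: blinfun.add_right)
      qed (rule xy)
      then show ?thesis by simp
    qed
    then have "p x \<le> p (x + y) - p y" using xy by (intro least)
    then show "p x + p y \<le> p (x + y)" by simp
  qed
  have p_scale_le: "p (c *\<^sub>R x) \<le> c * p x" if c: "0 < c" and x: "0 \<le> x" for c x
  proof (rule least)
    show "0 \<le> c *\<^sub>R x" using c x by (simp add: scaleR_nonneg_nonneg)
    fix y assume y: "0 \<le> y" "y \<le> c *\<^sub>R x"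
    have "inverse c *\<^sub>R y \<le> inverse c *\<^sub>R (c *\<^sub>R x)"
      by (rule scaleR_left_mono[OF y(2)]) (use c in simp)
    then have "inverse c *\<^sub>R y \<le> x" using c by simp
    moreover have "0 \<le> inverse c *\<^sub>R y"
      by (rule scaleR_nonneg_nonneg) (use c y in simp_all)
    ultimately have "blinfun_apply h (inverse c *\<^sub>R y) \<le> p x" by (intro upper)
    then have "c * (inverse c * blinfun_apply h y) \<le> c * p x"
      using c by (intro mult_left_mono) (simp_all add: blinfun.scaleR_right)
    moreover have "c * (inverse c * t) = t" for t using c by simp
    ultimately show "blinfun_apply h y \<le> c * p x" by metis
  qed
  have p_scale: "p (c *\<^sub>R x) = c * p x" if c: "0 < c" and x: "0 \<le> x" for c x
  proof (rule antisym[OF p_scale_le[OF c x]])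
    have "p (inverse c *\<^sub>R (c *\<^sub>R x)) \<le> inverse c * p (c *\<^sub>R x)"
      by (rule p_scale_le) (use c x in \<open>simp_all add: scaleR_nonneg_nonneg\<close>)
    moreover have "inverse c *\<^sub>R (c *\<^sub>R x) = x" using c by simp
    ultimately have "p x \<le> inverse c * p (c *\<^sub>R x)" by metis
    then have "c * p x \<le> c * (inverse c * p (c *\<^sub>R x))"
      using c by (intro mult_left_mono) auto
    moreover have "c * (inverse c * t) = t" for t using c by simp
    ultimately show "c * p x \<le> p (c *\<^sub>R x)" by metis
  qed
  define P where "P x = p (pprt x) - p (pprt (- x))" for x :: 'a
  have P_diff: "P x = p a - p b" if "x = a - b" "0 \<le> a" "0 \<le> b" for x a b
  proof -
    have "pprt x + b = a + pprt (- x)"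
    proof -
      have "pprt x - pprt (- x) = a - b" using pprt_decomp[of x] that(1) by simp
      then show ?thesis
        by (metis add.commute add_diff_eq diff_add_eq diff_eq_eq)
    qed
    then have "p (pprt x) + p b = p a + p (pprt (- x))"
      using p_add that by (metis zero_le_pprt)
    then show ?thesis by (simp add: P_def)
  qed
  have "bounded_linear P"
  proof (rule bounded_linear_intro)
    fix x y :: 'a
    have "x + y = (pprt x + pprt y) - (pprt (- x) + pprt (- y))"
      using pprt_decomp[of x] pprt_decomp[of y] by (metis add_diff_add)
    then have "P (x + y) = p (pprt x + pprt y) - p (pprt (- x) + pprt (- y))"
      by (rule P_diff) (simp_all add: add_nonneg_nonneg)
    then show "P (x + y) = P x + P y" by (simp add: p_add P_def)
  next
    fix c :: real and x :: 'a
    have pos: "P (d *\<^sub>R z) = d * P z" if d: "0 < d" for d :: real and z :: 'a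
    proof -
      have "d *\<^sub>R z = d *\<^sub>R pprt z - d *\<^sub>R pprt (- z)"
        using pprt_decomp[of z] by (metis scaleR_diff_right)
      then have "P (d *\<^sub>R z) = p (d *\<^sub>R pprt z) - p (d *\<^sub>R pprt (- z))"
        by (rule P_diff) (use d in \<open>auto intro!: scaleR_nonneg_nonneg\<close>)
      then show ?thesis using d by (simp add: p_scale P_def right_diff_distrib)
    qed
    have neg: "P (- z) = - P z" for z :: 'a by (simp add: P_def)
    have P0: "P 0 = 0" by (simp add: P_def)
    consider "c > 0" | "c = 0" | "c < 0" by linarith
    then show "P (c *\<^sub>R x) = c *\<^sub>R P x"
    proof cases
      case 3
      then have "P ((- c) *\<^sub>R x) = - c * P x" by (intro pos) simp
      then show ?thesis using neg[of "c *\<^sub>R x"] by simp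
    qed (use pos P0 in auto)
  next
    fix x :: 'a
    have "\<bar>P x\<bar> \<le> p (pprt x) + p (pprt (- x))"
      using p_nonneg[of "pprt x"] p_nonneg[of "pprt (- x)"] by (auto simp: P_def)
    also have "\<dots> \<le> norm h * norm (pprt x) + norm h * norm (pprt (- x))"
      by (intro add_mono p_le zero_le_pprt)
    also have "\<dots> \<le> norm h * norm x + norm h * norm x"
      using norm_pprt_le[of x] norm_pprt_le[of "- x"]
      by (intro add_mono mult_left_mono) auto
    finally show "norm (P x) \<le> norm x * (2 * norm h)" by (simp add: algebra_simps)
  qed
  then have app: "blinfun_apply (Blinfun P) = P" by (rule bounded_linear_Blinfun_apply)
  have P_pos: "P x = p x" if "0 \<le> x" for x
    using P_diff[of x x 0] that p_add[of 0 0] by simp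
  show ?thesis
  proof (intro exI conjI allI impI)
    show "0 \<le> Blinfun P" using p_nonneg by (simp add: less_eq_blinfun_def app P_pos)
    show "h \<le> Blinfun P" using upper by (simp add: less_eq_blinfun_def app P_pos)
    fix w :: "'a \<Rightarrow>\<^sub>L real" assume w: "0 \<le> w" "h \<le> w"
    show "Blinfun P \<le> w"
      unfolding less_eq_blinfun_def app
    proof (intro allI impI)
      fix x :: 'a assume x: "0 \<le> x"
      have "p x \<le> blinfun_apply w x"
      proof (rule least[OF x])
        fix y assume y: "0 \<le> y" "y \<le> x"
        have "0 \<le> blinfun_apply w (x - y)"
          using w(1) y by (simp add: less_eq_blinfun_def)
        then have "blinfun_apply w y \<le> blinfun_apply w x" by (simp add: blinfun.diff_right)
        moreover have "blinfun_apply h y \<le> blinfun_apply w y"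
          using w(2) y by (simp add: less_eq_blinfun_def)
        ultimately show "blinfun_apply h y \<le> blinfun_apply w x" by simp
      qed
      then show "P x \<le> blinfun_apply w x" using x by (simp add: P_pos)
    qed
  qed
qed

lemma ex_dual_sup:
  fixes f g :: "'a::banach_lattice \<Rightarrow>\<^sub>L real"
  shows "\<exists>u. isLub UNIV {f, g} u"
proof -
  obtain u where u: "0 \<le> u" "f - g \<le> u" "\<And>w. 0 \<le> w \<Longrightarrow> f - g \<le> w \<Longrightarrow> u \<le> w"
    using ex_dual_pos_part[of "f - g"] by blast
  have "isLub UNIV {f, g} (g + u)"
    unfolding isLub_def leastP_def isUb_def setle_def setge_def
  proof (intro conjI ballI UNIV_I)
    fix y assume "y \<in> {f, g}"
    then show "y \<le> g + u"
      using u(1,2) by (auto simp: less_eq_blinfun_def blinfun.bilinear_simps algebra_simps)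
  next
    fix w assume "w \<in> {x. (\<forall>y\<in>{f, g}. y \<le> x) \<and> x \<in> UNIV}"
    then have "u \<le> w - g"
      by (intro u(3)) (auto simp: less_eq_blinfun_def blinfun.bilinear_simps)
    then show "g + u \<le> w"
      by (auto simp: less_eq_blinfun_def blinfun.bilinear_simps algebra_simps)
  qed
  then show ?thesis ..
qed

lemma ex_dual_inf:
  fixes f g :: "'a::banach_lattice \<Rightarrow>\<^sub>L real"
  shows "\<exists>u. isGlb UNIV {f, g} u"
proof -
  have neg: "- a \<le> - b \<longleftrightarrow> b \<le> a" for a b :: "'a \<Rightarrow>\<^sub>L real"
    by (simp add: less_eq_blinfun_def blinfun.minus_left)
  obtain u where u: "isLub UNIV {- f, - g} u" using ex_dual_sup by blast
  have "- f \<le> u" "- g \<le> u" using u by (auto dest: isLubD2)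
  then have "- u \<le> f" "- u \<le> g" using neg by (metis minus_minus)+
  moreover have "w \<le> - u" if "w \<le> f" "w \<le> g" for w
  proof -
    have "u \<le> - w"
      using u that by (intro isLub_le_isUb[OF u]) (auto simp: isUb_def setle_def neg)
    then show ?thesis using neg by (metis minus_minus)
  qed
  ultimately have "isGlb UNIV {f, g} (- u)"
    by (auto simp: isGlb_def greatestP_def isLb_def setle_def setge_def)
  then show ?thesis ..
qed


section \<open>Almost limited sets and operators\<close>

definition weak_star_null :: "(nat \<Rightarrow> 'a::real_normed_vector \<Rightarrow>\<^sub>L real) \<Rightarrow> bool" where
  "weak_star_null f \<longleftrightarrow> (\<forall>x. (\<lambda>n. blinfun_apply (f n) x) \<longlonglongrightarrow> 0)"

definition weakly_null :: "(nat \<Rightarrow> 'a::real_normed_vector) \<Rightarrow> bool" where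
  "weakly_null x \<longleftrightarrow> (\<forall>f :: 'a \<Rightarrow>\<^sub>L real. (\<lambda>n. blinfun_apply f (x n)) \<longlonglongrightarrow> 0)"

definition disjoint_dual_seq :: "(nat \<Rightarrow> 'a::banach_lattice \<Rightarrow>\<^sub>L real) \<Rightarrow> bool" where
  "disjoint_dual_seq f \<longleftrightarrow> (\<forall>n m. n \<noteq> m \<longrightarrow> dual_disjoint (f n) (f m))"

definition almost_limited :: "'a::banach_lattice set \<Rightarrow> bool" where
  "almost_limited A \<longleftrightarrow> bounded A \<and>
     (\<forall>f. disjoint_dual_seq f \<and> weak_star_null f \<longrightarrow>
        uniform_limit A (\<lambda>n x. blinfun_apply (f n) x) (\<lambda>x. 0) sequentially)"

text \<open>Almost limited completely continuous operators.\<close>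

definition alcc :: "('a::banach_lattice \<Rightarrow> 'b::banach) \<Rightarrow> bool" where
  "alcc T \<longleftrightarrow> bounded_linear T \<and>
     (\<forall>x. almost_limited (range x) \<and> weakly_null x \<longrightarrow> (\<lambda>n. norm (T (x n))) \<longlonglongrightarrow> 0)"

definition positive_operator :: "('a::banach_lattice \<Rightarrow> 'b::banach_lattice) \<Rightarrow> bool" where
  "positive_operator T \<longleftrightarrow> linear T \<and> (\<forall>x\<ge>0. 0 \<le> T x)"

definition operator_le :: "('a::banach_lattice \<Rightarrow> 'b::banach_lattice) \<Rightarrow> ('a \<Rightarrow> 'b) \<Rightarrow> bool" where
  "operator_le S T \<longleftrightarrow> positive_operator (\<lambda>x. T x - S x)"

end

(*
  Band projections make the spaces behave like function spaces: u, E and F being fixed, an operator U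
  corresponds to the additive set function (P, B) |-> phi (B (U (P u))) on pairs of positive operators
  below the identity of E and of F. A finitely additive Radon-Nikodym argument (a partition whose
  quadratic energy sum S^2/T is almost maximal) approximates S, uniformly on [-u, u] and with respect
  to phi (|.|), by finite sums R of operators f B T P with 0 <= f <= 1. If (x n) is almost limited and
  weakly null, then so is (P (x n)), hence R (x n) -> 0.

  It remains to truncate (x n) to an order interval up to a remainder that T makes small. If this
  failed, there would be disjoint w n <= (x n)^+, after passing to a subsequence, with T (w n) not
  tending to 0. The projections P_A onto the bands generated by {w n | n in A} satisfy
  T (P_A (x n)) -> 0 for every A, and a sliding hump argument in A (possible because the norm of F is
  order continuous) yields T (w n) -> 0, a contradiction.

  Thus phi |S (x n)| -> 0 for every positive phi, and on order bounded sequences of positive elements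
  this implies norm convergence, again by order continuity.
*)
theory Submission
  imports Defs
begin

text \<open>Why cells are two-sided: \<open>S\<close> and \<open>T\<close> need not preserve
  disjointness, so projections of E alone cannot in general express \<open>S\<close> through
  \<open>T\<close>. Cutting F as well makes (P, B) behave like a rectangle in a product, on which
  \<open>S\<close> has a density with respect to \<open>T\<close>. The functional
  \<open>\<phi>\<close> is there because the energy argument needs scalar masses; the price is that
  S (x n) is controlled only weakly. The way back to the norm needs order bounded sequences, and S
  (x n) need not be one: its modulus is cut at S u, where u is the truncation level of x. What is
  cut off is always measured by \<open>T\<close>, since |S v| and |R v| both lie below T |v|; hence
  the remainder only has to be small after applying \<open>T\<close>. Order continuity of the norm
  of F serves three times: for band projections in F, for the exhaustivity behind the sliding hump,
  and for passing from weak to norm convergence. sigma-Dedekind completeness of E enters through its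
  principal band projections. That (P (x n)) stays almost limited rests on |f o P| <= |f|: composing
  with P keeps disjoint functionals disjoint.\<close>

lemmas [simp del] = neg_inf_eq_sup neg_sup_eq_inf diff_inf_eq_sup diff_sup_eq_inf

text \<open>The cone is the zero set of the map taking x to \<open>inf x 0\<close>, which is
  nonexpansive because the norm is monotone in the modulus. Passing inequalities to norm limits
  rests on this.\<close>

lemma nonneg_closed: "closed {x::'a::banach_lattice. 0 \<le> x}"
proof -
  have inf_close: "norm (inf x 0 - inf y 0) \<le> norm (x - y)" for x y :: 'a
  proof (rule norm_mono_abs, rule abs_leI)
    have "inf x 0 \<le> inf y 0 + \<bar>x - y\<bar>" for x y :: 'a
    proof -
      have "x \<le> y + \<bar>x - y\<bar>"
        using abs_ge_self[of "x - y"] by (simp add: algebra_simps)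
      moreover have "0 \<le> 0 + \<bar>x - y\<bar>" by simp
      ultimately have "inf x 0 \<le> inf (y + \<bar>x - y\<bar>) (0 + \<bar>x - y\<bar>)"
        by (intro inf_mono)
      then show ?thesis by (simp only: add_inf_distrib_right)
    qed
    from this[of x y] this[of y x]
    show "inf x 0 - inf y 0 \<le> \<bar>x - y\<bar>" "- (inf x 0 - inf y 0) \<le> \<bar>x - y\<bar>"
      by (simp_all add: algebra_simps abs_minus_commute)
  qed
  have "isCont (\<lambda>x::'a. inf x 0) x" for x
    unfolding isCont_def
  proof (rule LIM_zero_cancel, rule Lim_null_comparison)
    show "((\<lambda>y. norm (y - x)) \<longlongrightarrow> 0) (at x)"
      by (rule tendsto_norm_zero, rule LIM_zero) simp
    show "\<forall>\<^sub>F y in at x. norm (inf y 0 - inf x 0) \<le> norm (y - x)"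
      using inf_close by simp
  qed
  then have "closed {x::'a. inf x 0 = 0}"
    by (intro closed_Collect_eq continuous_at_imp_continuous_on) simp_all
  moreover have "{x::'a. inf x 0 = 0} = {x. 0 \<le> x}"
    by (auto simp: le_iff_inf inf_commute)
  ultimately show ?thesis by simp
qed

lemma tendsto_le_banach_lattice:
  fixes f g :: "'i \<Rightarrow> 'a::banach_lattice"
  assumes "(f \<longlongrightarrow> a) F" "(g \<longlongrightarrow> b) F" "F \<noteq> bot" "\<forall>\<^sub>F i in F. f i \<le> g i"
  shows "a \<le> b"
proof -
  have "((\<lambda>i. g i - f i) \<longlongrightarrow> b - a) F" by (intro tendsto_intros assms)
  then have "b - a \<in> {x. 0 \<le> x}"
    by (rule Lim_in_closed_set[OF nonneg_closed _ assms(3), rotated])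
       (use assms(4) in eventually_elim, simp)
  then show ?thesis by simp
qed

text \<open>Dividing by n bounds h by multiples of z that tend to 0 in norm; the closed cone then
  supplies the Archimedean property, which is not among the axioms of the class.\<close>

lemma archimedean_nonpos:
  fixes h z :: "'a::banach_lattice"
  assumes "\<And>n::nat. real n *\<^sub>R h \<le> z"
  shows "h \<le> 0"
proof (rule tendsto_le_banach_lattice)
  show "(\<lambda>n. (1 / real (Suc n)) *\<^sub>R z) \<longlonglongrightarrow> 0"
    using tendsto_scaleR[OF LIMSEQ_Suc[OF lim_inverse_n'] tendsto_const[of z]]
    by (simp del: of_nat_Suc)
  show "\<forall>\<^sub>F n in sequentially. h \<le> (1 / real (Suc n)) *\<^sub>R z"
  proof (rule always_eventually, rule allI)
    fix n
    have "(1 / real (Suc n)) *\<^sub>R (real (Suc n) *\<^sub>R h) \<le> (1 / real (Suc n)) *\<^sub>R z"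
      by (intro scaleR_left_mono assms) simp
    then show "h \<le> (1 / real (Suc n)) *\<^sub>R z" by (simp del: of_nat_Suc)
  qed
qed simp_all

section \<open>Moduli, positive parts and infima of sums\<close>

lemma abs_scaleR_le: "\<bar>c *\<^sub>R a\<bar> \<le> \<bar>c\<bar> *\<^sub>R \<bar>a\<bar>" for a :: "'a::banach_lattice"
proof -
  have *: "\<bar>d *\<^sub>R a\<bar> \<le> d *\<^sub>R \<bar>a\<bar>" if "0 \<le> d" for d and a :: 'a
  proof (rule abs_leI)
    show "d *\<^sub>R a \<le> d *\<^sub>R \<bar>a\<bar>" by (intro scaleR_left_mono abs_ge_self that)
    have "d *\<^sub>R (- a) \<le> d *\<^sub>R \<bar>a\<bar>" by (intro scaleR_left_mono abs_ge_minus_self that)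
    then show "- (d *\<^sub>R a) \<le> d *\<^sub>R \<bar>a\<bar>" by simp
  qed
  show ?thesis
  proof (cases "0 \<le> c")
    case True with *[of c a] show ?thesis by simp
  next
    case False with *[of "- c" "a"] show ?thesis by simp
  qed
qed

lemma norm_abs: "norm \<bar>x\<bar> = norm (x :: 'a::banach_lattice)"
  by (rule antisym; rule norm_mono_abs) simp_all

lemma abs_pprt: "\<bar>x\<bar> = pprt x + pprt (- x)" for x :: "'a::lattice_ab_group_add_abs"
  by (simp add: abs_prts pprt_neg)

text \<open>By distributivity the right side is the infimum of the four sums a + b, a + c, c + b and
  c + c, and positivity puts \<open>inf (a + b) c\<close> below each of them.\<close>

lemma inf_add_le:
  fixes a b c :: "'a::lattice_ab_group_add"
  assumes "0 \<le> a" "0 \<le> b" "0 \<le> c"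
  shows "inf (a + b) c \<le> inf a c + inf b c"
proof -
  have "inf (a + b) c \<le> a + b" by simp
  moreover have "inf (a + b) c \<le> c + b" "inf (a + b) c \<le> a + c" "inf (a + b) c \<le> c + c"
    using assms by (auto intro: le_infI2 simp: add_increasing add_increasing2)
  ultimately show ?thesis
    by (simp add: add_inf_distrib_left add_inf_distrib_right)
qed

section \<open>Disjointness\<close>

definition lat_disj :: "'a::banach_lattice \<Rightarrow> 'a \<Rightarrow> bool" where
  "lat_disj a b \<longleftrightarrow> inf \<bar>a\<bar> \<bar>b\<bar> = 0"

lemma lat_disj_commute: "lat_disj a b \<longleftrightarrow> lat_disj b a"
  by (simp add: lat_disj_def inf_commute)

lemma lat_disj_leI:
  assumes "lat_disj a b" "\<bar>c\<bar> \<le> \<bar>a\<bar>" shows "lat_disj c b"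
proof -
  have "inf \<bar>c\<bar> \<bar>b\<bar> \<le> inf \<bar>a\<bar> \<bar>b\<bar>" using assms(2) by (intro inf_mono) auto
  then show ?thesis using assms(1) unfolding lat_disj_def by (intro antisym) auto
qed

lemma lat_disj_le2I:
  assumes "lat_disj a b" "\<bar>c\<bar> \<le> \<bar>a\<bar>" "\<bar>d\<bar> \<le> \<bar>b\<bar>" shows "lat_disj c d"
  by (rule lat_disj_leI[OF _ assms(2)], subst lat_disj_commute, rule lat_disj_leI[OF _ assms(3)])
    (use assms(1) in \<open>simp add: lat_disj_commute\<close>)

lemma lat_disj_zero [simp]: "lat_disj 0 a" "lat_disj a 0"
  by (simp_all add: lat_disj_def inf_absorb1 inf_absorb2)

lemma lat_disj_abs [simp]: "lat_disj \<bar>a\<bar> b \<longleftrightarrow> lat_disj a b" "lat_disj a \<bar>b\<bar> \<longleftrightarrow> lat_disj a b"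
  by (simp_all add: lat_disj_def)

lemma lat_disj_uminus [simp]: "lat_disj (- a) b \<longleftrightarrow> lat_disj a b" "lat_disj a (- b) \<longleftrightarrow> lat_disj a b"
  by (simp_all add: lat_disj_def)

lemma lat_disj_add:
  assumes "lat_disj a c" "lat_disj b c" shows "lat_disj (a + b) c"
proof -
  have "inf (\<bar>a\<bar> + \<bar>b\<bar>) \<bar>c\<bar> \<le> inf \<bar>a\<bar> \<bar>c\<bar> + inf \<bar>b\<bar> \<bar>c\<bar>"
    by (intro inf_add_le) simp_all
  also have "\<dots> = 0" using assms by (simp add: lat_disj_def)
  finally have "inf (\<bar>a\<bar> + \<bar>b\<bar>) \<bar>c\<bar> = 0" by (intro antisym) simp_all
  then have "lat_disj (\<bar>a\<bar> + \<bar>b\<bar>) c" by (simp add: lat_disj_def)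
  then show ?thesis by (rule lat_disj_leI) (simp add: abs_triangle_ineq)
qed

lemma lat_disj_diff: "lat_disj a c \<Longrightarrow> lat_disj b c \<Longrightarrow> lat_disj (a - b) c"
  using lat_disj_add[of a c "- b"] by simp

lemma lat_disj_of_nat_scaleR: "lat_disj a c \<Longrightarrow> lat_disj (real n *\<^sub>R a) c"
  by (induction n) (auto simp: scaleR_left_distrib intro: lat_disj_add)

lemma lat_disj_scaleR: assumes "lat_disj a c" shows "lat_disj (r *\<^sub>R a) c"
proof -
  obtain n :: nat where n: "\<bar>r\<bar> \<le> real n" using real_arch_simple by blast
  have "\<bar>r *\<^sub>R a\<bar> \<le> \<bar>r\<bar> *\<^sub>R \<bar>a\<bar>" by (rule abs_scaleR_le)
  also have "\<dots> \<le> real n *\<^sub>R \<bar>a\<bar>" using n by (intro scaleR_right_mono) auto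
  also have "\<dots> \<le> \<bar>real n *\<^sub>R \<bar>a\<bar>\<bar>" by (rule abs_ge_self)
  finally show ?thesis
    using lat_disj_leI[OF lat_disj_of_nat_scaleR[of "\<bar>a\<bar>" c n]] assms by simp
qed

lemma lat_disj_self: "lat_disj a a \<Longrightarrow> a = 0"
  by (simp add: lat_disj_def)

text \<open>Translation by \<open>pprt (- x)\<close> reduces the infimum to \<open>inf x 0\<close>,
  which is \<open>- pprt (- x)\<close>.\<close>

lemma lat_disj_pprt: "lat_disj (pprt x) (pprt (- x))"
proof -
  have "pprt x = x + pprt (- x)" using pprt_decomp[of x] by (simp add: algebra_simps)
  then have "inf (pprt x) (pprt (- x)) = inf (x + pprt (- x)) (0 + pprt (- x))" by simp
  also have "\<dots> = inf x 0 + pprt (- x)" by (simp only: add_inf_distrib_right)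
  also have "\<dots> = 0" by (simp add: pprt_neg nprt_def)
  finally show ?thesis by (simp add: lat_disj_def)
qed

text \<open>As c d >= 1, the second element lies below 1/c times the negative part of a - c b, which
  is disjoint from the positive part. Disjoint sequences are manufactured from this in
  \<open>almost_order_bounded\<close>.\<close>

lemma lat_disj_pprt_scaleR: "lat_disj (pprt (a - c *\<^sub>R b)) (pprt (b - d *\<^sub>R a))"
  if "0 \<le> a" "0 \<le> b" "0 < c" "1 \<le> c * d" for a b :: "'a::banach_lattice"
proof -
  have "b - d *\<^sub>R a \<le> b - (1 / c) *\<^sub>R a"
    using that by (intro diff_left_mono scaleR_right_mono) (simp_all add: field_simps)
  also have "\<dots> = (1 / c) *\<^sub>R (- (a - c *\<^sub>R b))" using that by (simp add: scaleR_diff_right)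
  also have "\<dots> \<le> (1 / c) *\<^sub>R pprt (- (a - c *\<^sub>R b))"
    using that by (intro scaleR_left_mono) (simp_all add: pprt_def)
  finally have "pprt (b - d *\<^sub>R a) \<le> (1 / c) *\<^sub>R pprt (- (a - c *\<^sub>R b))"
    using that by (simp add: pprt_def[of "b - d *\<^sub>R a"] scaleR_nonneg_nonneg)
  moreover have "lat_disj (pprt (a - c *\<^sub>R b)) ((1 / c) *\<^sub>R pprt (- (a - c *\<^sub>R b)))"
    using lat_disj_pprt lat_disj_scaleR lat_disj_commute by blast
  ultimately show ?thesis
    using that by (elim lat_disj_le2I) (simp_all add: scaleR_nonneg_nonneg)
qed

text \<open>From - y <= z the negative part of y lies below both |y| and |z|, so it is 0. Applied to
  a band component and its complement, it shows that band projections are central.\<close>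

lemma lat_disj_add_nonneg:
  assumes "lat_disj y z" "0 \<le> y + z" shows "0 \<le> y"
proof -
  have "pprt (- y) \<le> pprt z"
    using assms(2) by (intro pprt_mono) (metis add.commute add_le_cancel_left add.right_inverse)
  moreover have "pprt z \<le> \<bar>z\<bar>" "pprt (- y) \<le> \<bar>y\<bar>"
    by (simp_all add: abs_pprt)
  ultimately have "pprt (- y) \<le> inf \<bar>y\<bar> \<bar>z\<bar>" by simp
  then have "pprt (- y) = 0" using assms(1) unfolding lat_disj_def by (intro antisym) simp_all
  then show ?thesis using le_zero_iff_zero_pprt[of "- y"] by simp
qed

lemma lat_disj_tendsto:
  assumes "f \<longlonglongrightarrow> a" "\<And>n::nat. lat_disj (f n) b" shows "lat_disj a b"
proof -
  have "norm (inf \<bar>a\<bar> \<bar>b\<bar>) \<le> norm (a - f n)" for n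
  proof (rule norm_mono_nonneg[THEN order_trans])
    have "inf \<bar>a\<bar> \<bar>b\<bar> \<le> inf (\<bar>a - f n\<bar> + \<bar>f n\<bar>) \<bar>b\<bar>"
      using abs_triangle_ineq[of "a - f n" "f n"] by (intro inf_mono) simp_all
    also have "\<dots> \<le> inf \<bar>a - f n\<bar> \<bar>b\<bar> + inf \<bar>f n\<bar> \<bar>b\<bar>" by (rule inf_add_le) simp_all
    also have "\<dots> \<le> \<bar>a - f n\<bar>" using assms(2)[of n] by (simp add: lat_disj_def)
    finally show "inf \<bar>a\<bar> \<bar>b\<bar> \<le> \<bar>a - f n\<bar>" .
  qed (simp_all add: norm_abs)
  moreover have "(\<lambda>n. norm (a - f n)) \<longlonglongrightarrow> 0"
    using tendsto_diff[OF tendsto_const[of a] assms(1)] by (simp add: tendsto_norm_zero)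
  ultimately have "norm (inf \<bar>a\<bar> \<bar>b\<bar>) \<le> 0"
    by (intro LIMSEQ_le_const) auto
  then show ?thesis by (simp add: lat_disj_def)
qed

section \<open>Band projections\<close>

text \<open>The supremum is the component of x in the band generated by w. Both spaces have this
  property, for different reasons: E by sigma-Dedekind completeness, F by order continuity of its
  norm.\<close>

definition principal_projection_property :: "'a::banach_lattice itself \<Rightarrow> bool" where
  "principal_projection_property _ \<longleftrightarrow> (\<forall>(w::'a)\<ge>0. \<forall>x\<ge>0. \<exists>s. isLub UNIV (range (\<lambda>n::nat. inf (real n *\<^sub>R w) x)) s)"

text \<open>Idempotence is not demanded, so that averages of band projections qualify, as needed in
  \<open>freudenthal\<close>.\<close>

definition central :: "('a::banach_lattice \<Rightarrow> 'a) \<Rightarrow> bool" where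
  "central P \<longleftrightarrow> linear P \<and> (\<forall>x\<ge>0. 0 \<le> P x \<and> P x \<le> x)"

definition disj_complement :: "'a::banach_lattice set \<Rightarrow> 'a set" where
  "disj_complement D = {z. \<forall>d\<in>D. lat_disj z d}"

text \<open>The double complement is the band generated by w. Describing the component by membership
  instead of as a supremum makes linearity a consequence of uniqueness.\<close>

definition band_proj :: "'a::banach_lattice \<Rightarrow> 'a \<Rightarrow> 'a" where
  "band_proj w x = (THE y. y \<in> disj_complement (disj_complement {w}) \<and> x - y \<in> disj_complement {w})"

lemma subspace_disj_complement: "subspace (disj_complement D)"
  unfolding subspace_def disj_complement_def by (auto intro: lat_disj_add lat_disj_scaleR)

lemma band_decomp_unique:
  assumes "y \<in> disj_complement (disj_complement {w})" "x - y \<in> disj_complement {w}"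
    and "y' \<in> disj_complement (disj_complement {w})" "x - y' \<in> disj_complement {w}"
  shows "y = y'"
proof -
  have "y - y' \<in> disj_complement (disj_complement {w})"
    by (rule subspace_diff[OF subspace_disj_complement assms(1,3)])
  moreover have "(x - y') - (x - y) \<in> disj_complement {w}"
    by (rule subspace_diff[OF subspace_disj_complement assms(4,2)])
  ultimately have "lat_disj (y - y') (y - y')" by (simp add: disj_complement_def)
  then show ?thesis using lat_disj_self by fastforce
qed

text \<open>The component y is the supremum of the \<open>a n\<close>. Each disjointness claim
  concerns an infimum h, and h <= 0 follows once y - h is again an upper bound: for x - y against w
  because a n + h <= a (n + 1), and for y against v because a n and h are disjoint, so that their
  sum is their supremum.\<close>

lemma band_decomp_ex_nonneg:
  fixes w x :: "'a::banach_lattice"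
  assumes "principal_projection_property TYPE('a)" "0 \<le> w" "0 \<le> x"
  shows "\<exists>y. y \<in> disj_complement (disj_complement {w}) \<and> x - y \<in> disj_complement {w}"
proof -
  define a where "a n = inf (real n *\<^sub>R w) x" for n :: nat
  obtain y where y: "isLub UNIV (range a) y"
    using assms unfolding principal_projection_property_def a_def by blast
  have ay: "a n \<le> y" for n using isLubD2[OF y] by simp
  have least: "y \<le> z" if "\<And>n. a n \<le> z" for z
    using that by (intro isLub_le_isUb[OF y]) (auto simp: isUb_def setle_def)
  have a0: "0 \<le> a n" for n using assms by (simp add: a_def scaleR_nonneg_nonneg)
  have y0: "0 \<le> y" using a0 ay order_trans by blast
  have yx: "y \<le> x" by (rule least) (simp add: a_def)
  have "inf (x - y) w \<le> 0"
  proof -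
    define h where "h = inf (x - y) w"
    have "y \<le> y - h"
    proof (rule least)
      fix n
      have "a n + h \<le> real n *\<^sub>R w + w" by (intro add_mono) (simp_all add: a_def h_def)
      moreover have "a n + h \<le> y + (x - y)" by (intro add_mono ay) (simp_all add: h_def)
      ultimately have "a n + h \<le> a (Suc n)"
        by (simp add: a_def scaleR_left_distrib add.commute)
      also have "\<dots> \<le> y" by (rule ay)
      finally show "a n \<le> y - h" by (simp add: algebra_simps)
    qed
    then show ?thesis by (simp add: h_def)
  qed
  then have "lat_disj (x - y) w" using yx assms by (auto simp: lat_disj_def intro: antisym)
  moreover have "lat_disj y v" if v: "lat_disj v w" for v
  proof -
    define h where "h = inf y \<bar>v\<bar>"
    have h0: "0 \<le> h" using y0 by (simp add: h_def)
    have "y \<le> y - h"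
    proof (rule least)
      fix n
      have "lat_disj (real n *\<^sub>R w) v" using v lat_disj_commute[of v w] lat_disj_scaleR[of w v] by simp
      then have "lat_disj (a n) h"
        by (rule lat_disj_le2I)
          (use a0 h0 assms in \<open>simp_all add: a_def h_def scaleR_nonneg_nonneg\<close>)
      then have "inf (a n) h = 0" using a0 h0 by (simp add: lat_disj_def)
      then have "a n + h = sup (a n) h" using add_eq_inf_sup[of "a n" h] by simp
      also have "\<dots> \<le> y" using ay by (simp add: h_def)
      finally show "a n \<le> y - h" by (simp add: algebra_simps)
    qed
    then have "h = 0" using h0 by (simp add: antisym)
    then show ?thesis using y0 by (simp add: lat_disj_def h_def)
  qed
  ultimately show ?thesis by (auto simp: disj_complement_def)
qed

lemma band_decomp_ex:
  fixes w x :: "'a::banach_lattice"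
  assumes "principal_projection_property TYPE('a)" "0 \<le> w"
  shows "\<exists>y. y \<in> disj_complement (disj_complement {w}) \<and> x - y \<in> disj_complement {w}"
proof -
  obtain y z where yz: "y \<in> disj_complement (disj_complement {w})" "pprt x - y \<in> disj_complement {w}"
    "z \<in> disj_complement (disj_complement {w})" "pprt (- x) - z \<in> disj_complement {w}"
    using band_decomp_ex_nonneg[OF assms] zero_le_pprt by metis
  have "(pprt x - y) - (pprt (- x) - z) = x - (y - z)"
    using pprt_decomp[of x] by (simp add: algebra_simps)
  then have "y - z \<in> disj_complement (disj_complement {w}) \<and> x - (y - z) \<in> disj_complement {w}"
    using yz subspace_diff[OF subspace_disj_complement] by metis
  then show ?thesis ..
qed

context
  fixes w :: "'a::banach_lattice"
  assumes ppp: "principal_projection_property TYPE('a)" and w: "0 \<le> w"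
begin

lemma band_proj_props: "band_proj w x \<in> disj_complement (disj_complement {w})" "x - band_proj w x \<in> disj_complement {w}"
proof -
  have "\<exists>!y. y \<in> disj_complement (disj_complement {w}) \<and> x - y \<in> disj_complement {w}"
    using band_decomp_ex[OF ppp w] band_decomp_unique by (intro ex_ex1I) blast+
  from theI'[OF this] show "band_proj w x \<in> disj_complement (disj_complement {w})" "x - band_proj w x \<in> disj_complement {w}"
    by (simp_all add: band_proj_def)
qed

lemma band_proj_eqI: "y \<in> disj_complement (disj_complement {w}) \<Longrightarrow> x - y \<in> disj_complement {w} \<Longrightarrow> band_proj w x = y"
  by (rule band_decomp_unique[OF band_proj_props])

lemma linear_band_proj: "linear (band_proj w)"
proof
  fix x y :: 'a
  show "band_proj w (x + y) = band_proj w x + band_proj w y"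
    using band_proj_props[of x] band_proj_props[of y] subspace_add[OF subspace_disj_complement]
    by (intro band_proj_eqI) (auto simp: add_diff_add)
next
  fix r and x :: 'a
  show "band_proj w (r *\<^sub>R x) = r *\<^sub>R band_proj w x"
    using band_proj_props[of x] subspace_scale[OF subspace_disj_complement]
    by (intro band_proj_eqI) (auto simp flip: scaleR_diff_right)
qed

lemma central_band_proj: "central (band_proj w)"
  unfolding central_def
proof (intro conjI allI impI linear_band_proj)
  fix x :: 'a assume x: "0 \<le> x"
  have d: "lat_disj (band_proj w x) (x - band_proj w x)" using band_proj_props[of x] by (auto simp: disj_complement_def)
  then show "0 \<le> band_proj w x" using lat_disj_add_nonneg[OF d] x by simp
  from d have "lat_disj (x - band_proj w x) (band_proj w x)" by (simp add: lat_disj_commute)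
  from lat_disj_add_nonneg[OF this] show "band_proj w x \<le> x" using x by simp
qed

lemma band_proj_ident: assumes "\<bar>y\<bar> \<le> w" shows "band_proj w y = y"
proof (rule band_proj_eqI)
  show "y \<in> disj_complement (disj_complement {w})"
  proof (clarsimp simp: disj_complement_def)
    fix z assume "lat_disj z w"
    then have "lat_disj w z" by (simp add: lat_disj_commute)
    then show "lat_disj y z" by (rule lat_disj_leI) (use assms w in simp)
  qed
qed (simp add: disj_complement_def)

lemma band_proj_disj: assumes "lat_disj y w" shows "band_proj w y = 0"
  by (rule band_proj_eqI) (use assms in \<open>auto simp: disj_complement_def\<close>)

end

text \<open>This makes the projections onto bands generated by subsets of a disjoint sequence a
  finitely additive function of the subset, as the sliding hump requires.\<close>

lemma band_proj_add:
  fixes v w :: "'a::banach_lattice"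
  assumes ppp: "principal_projection_property TYPE('a)" and "0 \<le> v" "0 \<le> w" "lat_disj v w"
  shows "band_proj (v + w) x = band_proj v x + band_proj w x"
proof (rule band_proj_eqI[OF ppp])
  have mono: "disj_complement (disj_complement {v}) \<subseteq> disj_complement (disj_complement {v + w})" if "0 \<le> v" "0 \<le> w" for v w :: 'a
    using that unfolding disj_complement_def
  proof clarsimp
    fix x z
    assume x: "\<forall>d. lat_disj d v \<longrightarrow> lat_disj x d" and "lat_disj z (v + w)"
    then have "lat_disj (v + w) z" by (simp add: lat_disj_commute)
    then have "lat_disj v z" by (rule lat_disj_leI) (use that in simp)
    then show "lat_disj x z" using x lat_disj_commute by blast
  qed
  show "band_proj v x + band_proj w x \<in> disj_complement (disj_complement {v + w})"
    using mono[of v w] mono[of w v] band_proj_props[OF ppp, of v x] band_proj_props[OF ppp, of w x] assms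
    by (intro subspace_add[OF subspace_disj_complement]) (auto simp: add.commute)
  have "lat_disj (x - band_proj v x) v" "lat_disj (x - band_proj w x) w"
    using band_proj_props[OF ppp] assms by (auto simp: disj_complement_def)
  moreover have "lat_disj (band_proj v x) w" "lat_disj (band_proj w x) v"
    using band_proj_props[OF ppp, of v x] band_proj_props[OF ppp, of w x] assms
    by (auto simp: disj_complement_def lat_disj_commute)
  ultimately have "lat_disj (x - band_proj v x - band_proj w x) v" "lat_disj (x - band_proj w x - band_proj v x) w"
    by (auto intro: lat_disj_diff)
  then have "lat_disj (x - (band_proj v x + band_proj w x)) v" "lat_disj (x - (band_proj v x + band_proj w x)) w"
    by (simp_all add: algebra_simps)
  then show "x - (band_proj v x + band_proj w x) \<in> disj_complement {v + w}"
    unfolding disj_complement_def by (auto simp: lat_disj_commute intro: lat_disj_add)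
qed (use assms in simp)

text \<open>The band generated by the positive part plays the role of the set where x > 0: its
  projection fixes \<open>pprt x\<close> and kills \<open>pprt (- x)\<close>.\<close>

lemma band_proj_pprt:
  fixes x :: "'a::banach_lattice"
  assumes "principal_projection_property TYPE('a)"
  shows "band_proj (pprt x) x = pprt x"
proof -
  have "band_proj (pprt x) (pprt x) - band_proj (pprt x) (pprt (- x)) = band_proj (pprt x) x"
    using linear_diff[OF linear_band_proj[OF assms]] pprt_decomp[of x] by (metis zero_le_pprt)
  then show ?thesis using assms by (simp add: band_proj_ident band_proj_disj lat_disj_pprt lat_disj_commute)
qed

section \<open>Central operators\<close>

lemma central_nonneg: "central P \<Longrightarrow> 0 \<le> x \<Longrightarrow> 0 \<le> P x"
  and central_le: "central P \<Longrightarrow> 0 \<le> x \<Longrightarrow> P x \<le> x"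
  and central_linear: "central P \<Longrightarrow> linear P"
  by (auto simp: central_def)

lemma positive_mono:
  assumes "positive_operator T" "x \<le> y" shows "T x \<le> T y"
proof -
  have "0 \<le> T (y - x)" using assms by (simp add: positive_operator_def)
  then show ?thesis using assms linear_diff[of T y x] by (simp add: positive_operator_def)
qed

lemma positive_abs:
  assumes "positive_operator T" "\<bar>x\<bar> \<le> y" shows "\<bar>T x\<bar> \<le> T y"
proof (rule abs_leI)
  have "x \<le> y" "- x \<le> y" using assms(2) abs_le_iff by auto
  then have "T x \<le> T y" "T (- x) \<le> T y" by (auto intro: positive_mono[OF assms(1)])
  moreover have "T (- x) = - T x" using assms by (simp add: positive_operator_def linear_neg)
  ultimately show "T x \<le> T y" "- T x \<le> T y" by auto
qed

lemma central_positive: "central P \<Longrightarrow> positive_operator P"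
  by (simp add: central_def positive_operator_def)

lemma central_abs_le: "central P \<Longrightarrow> \<bar>P x\<bar> \<le> \<bar>x\<bar>"
  by (rule order_trans[OF positive_abs[OF central_positive order_refl]])
     (auto intro: central_le)

lemma central_norm_le: "central P \<Longrightarrow> norm (P x) \<le> norm x"
  by (rule norm_mono_abs, rule central_abs_le)

lemma central_bounded_linear: "central P \<Longrightarrow> bounded_linear P"
  using central_norm_le[of P] central_linear[of P]
  by (intro bounded_linear_intro[where K = 1]) (auto simp: linear_add linear_scale)

lemma central_compl: "central P \<Longrightarrow> central (\<lambda>x. x - P x)"
  unfolding central_def by (auto intro!: linear_compose_sub linear_ident)

lemma central_comp: "central P \<Longrightarrow> central Q \<Longrightarrow> central (P \<circ> Q)"
  unfolding central_def using linear_compose[of Q P]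
  by (auto intro: order_trans[of "P (Q x)" "Q x" x for x])

lemma positive_bounded_linear_mono:
  assumes S: "positive_operator S" and le: "operator_le S T" and T: "bounded_linear T"
  shows "bounded_linear S"
proof -
  obtain K where K: "\<And>x. norm (T x) \<le> norm x * K" using bounded_linear.bounded[OF T] by blast
  have "norm (S x) \<le> norm x * K" for x
  proof -
    have "\<bar>S x\<bar> \<le> S \<bar>x\<bar>" by (rule positive_abs[OF S order_refl])
    also have "\<dots> \<le> T \<bar>x\<bar>" using le by (simp add: operator_le_def positive_operator_def)
    also have "\<dots> \<le> \<bar>T \<bar>x\<bar>\<bar>" by (rule abs_ge_self)
    finally have "norm (S x) \<le> norm (T \<bar>x\<bar>)" by (rule norm_mono_abs)
    also have "\<dots> \<le> norm x * K" using K[of "\<bar>x\<bar>"] by (simp add: norm_abs)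
    finally show ?thesis .
  qed
  then show ?thesis
    using S by (intro bounded_linear_intro[where K = K])
      (auto simp: positive_operator_def linear_add linear_scale)
qed

text \<open>A layer-cake formula: \<open>P k\<close> stands for the indicator of the set where x >
  (k/N) u, and M is the average of these N projections. The layers g k - g (k + 1) sum to x and are
  squeezed between (1/N) P (k + 1) u and (1/N) P k u, whence x <= M u <= x + (1/N) u.\<close>

lemma freudenthal:
  fixes u x :: "'a::banach_lattice"
  assumes ppp: "principal_projection_property TYPE('a)" and x: "0 \<le> x" "x \<le> u" and e: "0 < e"
  obtains M where "central M" "norm (M u - x) \<le> e"
proof -
  obtain N :: nat where N: "norm u / e < real N" using reals_Archimedean2 by blast
  have "0 \<le> norm u / e" using e by simp
  then have N0: "0 < N" using N by (simp add: gr0I)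
  have u: "0 \<le> u" using x by simp
  define g where "g k = pprt (x - (real k / real N) *\<^sub>R u)" for k :: nat
  define P where "P k = band_proj (g k)" for k
  have g0: "0 \<le> g k" for k by (simp add: g_def)
  have cP: "central (P k)" for k using central_band_proj[OF ppp g0] by (simp add: P_def)
  have Pg: "P k (x - (real k / real N) *\<^sub>R u) = g k" for k
    using band_proj_pprt[OF ppp] by (simp add: P_def g_def)
  have step: "x - (real (Suc k) / real N) *\<^sub>R u = (x - (real k / real N) *\<^sub>R u) - (1 / real N) *\<^sub>R u" for k
    by (simp add: field_simps scaleR_left_distrib add_divide_distrib)
  have gdec: "g (Suc k) \<le> g k" for k
    unfolding g_def by (intro pprt_mono) (simp only: step, simp add: u scaleR_nonneg_nonneg)
  \<comment> \<open>A layer is at most (1/N) u and lies in the band of \<open>g k\<close>, so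
    applying \<open>P k\<close> sharpens the bound to (1/N) P k u.\<close>
  have up: "g k - g (Suc k) \<le> (1 / real N) *\<^sub>R P k u" for k
  proof -
    define t where "t = x - (real k / real N) *\<^sub>R u"
    have t: "x - (real (Suc k) / real N) *\<^sub>R u = t - (1 / real N) *\<^sub>R u" by (simp only: step t_def)
    have "t \<le> pprt (t - (1 / real N) *\<^sub>R u) + (1 / real N) *\<^sub>R u"
      by (simp add: pprt_def add_sup_distrib_right)
    moreover have "0 \<le> pprt (t - (1 / real N) *\<^sub>R u) + (1 / real N) *\<^sub>R u"
      using u by (simp add: scaleR_nonneg_nonneg add_nonneg_nonneg)
    ultimately have "pprt t - pprt (t - (1 / real N) *\<^sub>R u) \<le> (1 / real N) *\<^sub>R u"
      by (simp add: pprt_def[of t] algebra_simps)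
    then have "g k - g (Suc k) \<le> (1 / real N) *\<^sub>R u" by (simp only: g_def t flip: t_def)
    then have "P k (g k - g (Suc k)) \<le> P k ((1 / real N) *\<^sub>R u)"
      by (rule positive_mono[OF central_positive[OF cP]])
    moreover have "P k (g k - g (Suc k)) = g k - g (Suc k)"
      unfolding P_def using gdec[of k] g0[of "Suc k"]
      by (intro band_proj_ident[OF ppp g0]) simp
    ultimately show ?thesis by (simp add: linear_scale[OF central_linear[OF cP]])
  qed
  have lo: "(1 / real N) *\<^sub>R P (Suc k) u \<le> g k - g (Suc k)" for k
  proof -
    define t where "t = x - (real k / real N) *\<^sub>R u"
    have t: "x - (real (Suc k) / real N) *\<^sub>R u = t - (1 / real N) *\<^sub>R u" by (simp only: step t_def)
    have "P (Suc k) t - (1 / real N) *\<^sub>R P (Suc k) u = g (Suc k)"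
      using Pg[of "Suc k"] unfolding t
      by (simp add: linear_diff[OF central_linear[OF cP]] linear_scale[OF central_linear[OF cP]])
    moreover have "P (Suc k) t \<le> P (Suc k) (g k)"
      by (rule positive_mono[OF central_positive[OF cP]]) (simp add: g_def t_def pprt_def)
    moreover have "P (Suc k) (g k) \<le> g k" by (rule central_le[OF cP g0])
    ultimately show ?thesis by (simp add: algebra_simps)
  qed
  define M where "M y = (\<Sum>k<N. (1 / real N) *\<^sub>R P k y)" for y
  have tel: "(\<Sum>k<N. g k - g (Suc k)) = x"
  proof -
    have "(\<Sum>k<N. g k - g (Suc k)) = g 0 - g N" by (rule sum_lessThan_telescope')
    moreover have "g N = 0" using N0 x by (simp add: g_def)
    ultimately show ?thesis using x by (simp add: g_def)
  qed
  have cM: "central M"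
    unfolding central_def
  proof (intro conjI allI impI)
    show "linear M" unfolding M_def
      by (rule linear_compose_sum, rule ballI, rule linear_compose_scale_right[OF central_linear[OF cP]])
    fix y :: 'a assume y: "0 \<le> y"
    show "0 \<le> M y" unfolding M_def
      by (intro sum_nonneg scaleR_nonneg_nonneg central_nonneg[OF cP] y) simp
    have "M y \<le> (\<Sum>k<N. (1 / real N) *\<^sub>R y)" unfolding M_def
      by (intro sum_mono scaleR_left_mono central_le[OF cP] y) simp
    also have "\<dots> = y" using N0 by (simp add: sum_constant_scaleR)
    finally show "M y \<le> y" .
  qed
  have "x \<le> M u" unfolding M_def tel[symmetric] by (intro sum_mono up)
  moreover have "M u - (1 / real N) *\<^sub>R u \<le> x"
  proof -
    \<comment> \<open>The lower bounds use the projections 1, ..., N, while M uses 0, ..., N - 1;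
      the two sums differ only in the end terms, by at most (1/N) u.\<close>
    have "M u + (1 / real N) *\<^sub>R P N u - (1 / real N) *\<^sub>R P 0 u = (\<Sum>k<N. (1 / real N) *\<^sub>R P (Suc k) u)"
      using sum.lessThan_Suc_shift[of "\<lambda>k. (1 / real N) *\<^sub>R P k u" N]
      by (simp add: M_def algebra_simps)
    also have "\<dots> \<le> x" unfolding tel[symmetric] by (intro sum_mono lo)
    finally have "M u + (1 / real N) *\<^sub>R P N u \<le> x + (1 / real N) *\<^sub>R P 0 u"
      by (simp add: algebra_simps)
    moreover have "0 \<le> (1 / real N) *\<^sub>R P N u"
      by (intro scaleR_nonneg_nonneg central_nonneg[OF cP] u) simp
    moreover have "(1 / real N) *\<^sub>R P 0 u \<le> (1 / real N) *\<^sub>R u"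
      by (intro scaleR_left_mono central_le[OF cP] u) simp
    ultimately have "M u \<le> x + (1 / real N) *\<^sub>R u"
      by (meson add_left_mono le_add_same_cancel1 order_trans)
    then show ?thesis by (simp add: algebra_simps)
  qed
  ultimately have "norm (M u - x) \<le> norm ((1 / real N) *\<^sub>R u)"
    by (intro norm_mono_nonneg) (simp_all add: algebra_simps)
  also have "\<dots> \<le> e" using N N0 e by (simp add: field_simps)
  finally show ?thesis using cM that by blast
qed

section \<open>Order continuous norms\<close>

text \<open>The differences \<open>z - s n\<close>, with \<open>z\<close> an upper bound of the sequence, form a net
  decreasing to \<open>0\<close>; hence \<open>s\<close> is a Cauchy sequence.\<close>

lemma order_continuous_norm_incseq_convergent:
  fixes s :: "nat \<Rightarrow> 'a::banach_lattice"
  assumes oc: "order_continuous_norm TYPE('a)" and inc: "incseq s" and bnd: "\<And>n. s n \<le> w"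
  shows "convergent s"
proof -
  \<comment> \<open>Upper bounds run downwards and indices upwards; infima of upper bounds make the
    index set directed. The indices are pairs, hence the later appeal to
    \<open>order_continuous_norm_any_index\<close>.\<close>
  define I where "I = {z. \<forall>n. s n \<le> z} \<times> (UNIV :: nat set)"
  define r where "r = (\<lambda>(z::'a, n::nat) (z', n'). z' \<le> z \<and> n \<le> n')"
  define x where "x = (\<lambda>(z, n). z - s n)"
  have mono: "s m \<le> s n" if "m \<le> n" for m n using inc that by (simp add: incseqD)
  have dir: "directed_by I r"
    unfolding directed_by_def
  proof (intro conjI ballI impI)
    show "I \<noteq> {}" using bnd by (auto simp: I_def)
    show "r i i" for i by (cases i) (simp add: r_def)
    show "r i k" if "r i j" "r j k" for i j k
      using that by (cases i; cases j; cases k) (auto simp: r_def)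
    fix i j assume "i \<in> I" "j \<in> I"
    then have "(inf (fst i) (fst j), max (snd i) (snd j)) \<in> I"
      by (auto simp: I_def)
    moreover have "r i (inf (fst i) (fst j), max (snd i) (snd j))"
      "r j (inf (fst i) (fst j), max (snd i) (snd j))"
      by (auto simp: r_def split: prod.split)
    ultimately show "\<exists>k\<in>I. r i k \<and> r j k" by blast
  qed
  have dec: "x j \<le> x i" if "r i j" for i j
    using that by (cases i; cases j) (auto simp: r_def x_def intro!: diff_mono mono)
  have glb: "isGlb UNIV (x ` I) 0"
    unfolding isGlb_def greatestP_def isLb_def setle_def setge_def
  proof (intro conjI ballI UNIV_I)
    fix y assume "y \<in> x ` I"
    then show "0 \<le> y" by (auto simp: x_def I_def)
  next
    fix h assume "h \<in> {l. (\<forall>y\<in>x ` I. l \<le> y) \<and> l \<in> UNIV}"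
    then have h: "h \<le> z - s n" if "\<And>n. s n \<le> z" for z n
      using that by (auto simp: x_def I_def)
    \<comment> \<open>If h is a lower bound of the net, subtracting h from an upper bound of s gives
      another upper bound. Iterating k times from w leads to the Archimedean property.\<close>
    have "s n \<le> w - real k *\<^sub>R h" for k n
    proof (induction k arbitrary: n)
      case (Suc k)
      from h[OF Suc] show ?case by (simp add: algebra_simps)
    qed (use bnd in simp)
    from this[of 0] have "real k *\<^sub>R h \<le> w - s 0" for k
      by (simp add: algebra_simps)
    then show "h \<le> 0" by (rule archimedean_nonpos)
  qed
  have lim: "((\<lambda>i. norm (x i)) \<longlongrightarrow> 0) (net_filter I r)"
    by (rule order_continuous_norm_any_index[OF oc dir dec glb])
  have "Cauchy s"
  proof (rule metric_CauchyI)
    fix e :: real assume e: "0 < e"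
    then obtain i where i: "i \<in> I" "\<And>j. j \<in> I \<Longrightarrow> r i j \<Longrightarrow> norm (x j) < e"
      using lim unfolding tendsto_iff eventually_net_filter[OF dir] by fastforce
    obtain z n where zn: "i = (z, n)" by (cases i)
    have z: "s m \<le> z" for m using i(1) by (simp add: zn I_def)
    have *: "norm (s k - s m) < e" if "n \<le> m" "m \<le> k" for m k
    proof -
      have "norm (s k - s m) \<le> norm (z - s m)"
        using mono[OF that(2)] z[of k] by (intro norm_mono_nonneg) simp_all
      also have "\<dots> < e" using i(2)[of "(z, m)"] z that by (simp add: zn I_def r_def x_def)
      finally show ?thesis .
    qed
    have "dist (s m) (s k) < e" if "n \<le> m" "n \<le> k" for m k
      using *[of m k] *[of k m] that by (cases "m \<le> k") (simp_all add: dist_norm norm_minus_commute)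
    then show "\<exists>M. \<forall>m\<ge>M. \<forall>k\<ge>M. dist (s m) (s k) < e" by blast
  qed
  then show ?thesis by (simp add: Cauchy_convergent_iff)
qed

lemma incseq_lim_upper:
  fixes s :: "nat \<Rightarrow> 'a::banach_lattice"
  assumes "incseq s" "s \<longlonglongrightarrow> l" shows "s n \<le> l"
  by (rule tendsto_le_banach_lattice[OF tendsto_const assms(2)])
    (auto simp: eventually_sequentially intro: incseqD[OF assms(1)])

lemma lim_le_banach_lattice:
  fixes s :: "nat \<Rightarrow> 'a::banach_lattice"
  assumes "s \<longlonglongrightarrow> l" "\<And>n. s n \<le> z" shows "l \<le> z"
  by (rule tendsto_le_banach_lattice[OF assms(1) tendsto_const]) (use assms in auto)

text \<open>An order bounded increasing sequence converges in norm, and the closed cone makes its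
  limit the supremum.\<close>

lemma order_continuous_norm_principal_projection:
  assumes "order_continuous_norm TYPE('a::banach_lattice)"
  shows "principal_projection_property TYPE('a)"
  unfolding principal_projection_property_def
proof (intro allI impI)
  fix w x :: 'a assume "0 \<le> w" "0 \<le> x"
  define a where "a n = inf (real n *\<^sub>R w) x" for n :: nat
  have inc: "incseq a"
    unfolding a_def by (intro incseq_SucI inf_mono scaleR_right_mono) (simp_all add: \<open>0 \<le> w\<close>)
  have "convergent a"
    by (rule order_continuous_norm_incseq_convergent[OF assms inc, of x]) (simp add: a_def)
  then obtain l where l: "a \<longlonglongrightarrow> l" by (auto simp: convergent_def)
  have "isLub UNIV (range a) l"
    using incseq_lim_upper[OF inc l] lim_le_banach_lattice[OF l]
    by (auto simp: isLub_def leastP_def isUb_def setle_def setge_def)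
  then show "\<exists>s. isLub UNIV (range (\<lambda>n. inf (real n *\<^sub>R w) x)) s" by (auto simp: a_def)
qed

lemma sigma_dedekind_complete_principal_projection:
  assumes "sigma_dedekind_complete TYPE('a::banach_lattice)"
  shows "principal_projection_property TYPE('a)"
  unfolding principal_projection_property_def
proof (intro allI impI)
  fix w x :: 'a
  have "bdd_above (range (\<lambda>n::nat. inf (real n *\<^sub>R w) x))" by (rule bdd_aboveI[of _ x]) auto
  then show "\<exists>s. isLub UNIV (range (\<lambda>n::nat. inf (real n *\<^sub>R w) x)) s"
    using assms by (simp add: sigma_dedekind_complete_def)
qed

text \<open>The partial sums converge in norm, so the terms vanish. This supplies the exhaustivity
  condition of \<open>phillips_diagonal\<close>.\<close>

lemma order_continuous_norm_bounded_sums: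
  fixes y :: "nat \<Rightarrow> 'a::banach_lattice"
  assumes "order_continuous_norm TYPE('a)" "\<And>i. 0 \<le> y i" "\<And>n. (\<Sum>i<n. y i) \<le> z"
  shows "y \<longlonglongrightarrow> 0"
proof -
  have "convergent (\<lambda>n. \<Sum>i<n. y i)"
    by (rule order_continuous_norm_incseq_convergent[OF assms(1) _ assms(3)])
      (auto intro!: incseq_SucI assms(2))
  then have "summable y" by (simp add: summable_iff_convergent)
  then show ?thesis by (rule summable_LIMSEQ_zero)
qed

section \<open>The Hahn--Banach theorem\<close>

definition sublinear :: "('a::real_vector \<Rightarrow> real) \<Rightarrow> bool" where
  "sublinear q \<longleftrightarrow> (\<forall>x y. q (x + y) \<le> q x + q y) \<and> (\<forall>c\<ge>0. \<forall>x. q (c *\<^sub>R x) = c * q x)"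

lemma sublinearI:
  assumes add: "\<And>x y. q (x + y) \<le> q x + q y" and sc: "\<And>c x. 0 < c \<Longrightarrow> q (c *\<^sub>R x) \<le> c * q x"
    and "q 0 = 0"
  shows "sublinear q"
  unfolding sublinear_def
proof (intro conjI allI impI add)
  fix c :: real and x assume "0 \<le> c"
  consider "c = 0" | "0 < c" using \<open>0 \<le> c\<close> by linarith
  then show "q (c *\<^sub>R x) = c * q x"
  proof cases
    case 2
    have "q (inverse c *\<^sub>R c *\<^sub>R x) \<le> inverse c * q (c *\<^sub>R x)" by (rule sc) (use 2 in simp)
    then have "c * q x \<le> q (c *\<^sub>R x)" using 2 by (simp add: field_simps)
    then show ?thesis using sc[OF 2] by (simp add: antisym)
  qed (use assms in simp)
qed

lemma
  assumes "sublinear q"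
  shows sublinear_add: "q (x + y) \<le> q x + q y"
    and sublinear_scaleR: "0 \<le> c \<Longrightarrow> q (c *\<^sub>R x) = c * q x"
    and sublinear_zero: "q 0 = 0"
    and sublinear_ge_uminus: "- q (- x) \<le> q x"
proof -
  show "q (x + y) \<le> q x + q y" "0 \<le> c \<Longrightarrow> q (c *\<^sub>R x) = c * q x"
    using assms by (simp_all add: sublinear_def)
  have *: "q (0 *\<^sub>R x) = 0 * q x" using assms unfolding sublinear_def by blast
  then show "q 0 = 0" by simp
  have "q (x + - x) \<le> q x + q (- x)" using assms unfolding sublinear_def by blast
  then show "- q (- x) \<le> q x" using * by simp
qed

text \<open>The candidate is q' x = inf over t >= 0 of q (x + t z) - t q z, finite because it is
  bounded below by - q (- x); t = 1 gives the value at - z. It serves twice: to show that minimal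
  sublinear functionals are odd, and to prescribe the value of a norming functional.\<close>

lemma sublinear_lower:
  fixes q :: "'a::real_vector \<Rightarrow> real"
  assumes q: "sublinear q"
  obtains q' where "sublinear q'" "q' \<le> q" "q' (- z) \<le> - q z"
proof -
  define Q where "Q x = (\<lambda>t. q (x + t *\<^sub>R z) - t * q z) ` {0..}" for x
  define q' where "q' x = Inf (Q x)" for x
  have lower: "- q (- x) \<le> v" if "v \<in> Q x" for v x
  proof -
    from that obtain t where t: "0 \<le> t" "v = q (x + t *\<^sub>R z) - t * q z" by (auto simp: Q_def)
    have "t * q z = q ((x + t *\<^sub>R z) + (- x))" using sublinear_scaleR[OF q t(1)] by simp
    also have "\<dots> \<le> q (x + t *\<^sub>R z) + q (- x)" by (rule sublinear_add[OF q])
    finally show ?thesis using t by simp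
  qed
  have bdd: "bdd_below (Q x)" for x using lower by (intro bdd_belowI) blast
  have ne: "Q x \<noteq> {}" for x by (auto simp: Q_def)
  have le: "q' x \<le> q (x + t *\<^sub>R z) - t * q z" if "0 \<le> t" for x t
    unfolding q'_def by (rule cInf_lower[OF _ bdd]) (use that in \<open>auto simp: Q_def\<close>)
  have ge: "c \<le> q' x" if "\<And>t. 0 \<le> t \<Longrightarrow> c \<le> q (x + t *\<^sub>R z) - t * q z" for c x
    unfolding q'_def by (rule cInf_greatest[OF ne]) (use that in \<open>auto simp: Q_def\<close>)
  show ?thesis
  proof
    show "q' \<le> q"
    proof (rule le_funI)
      show "q' x \<le> q x" for x using le[of 0 x] by simp
    qed
    show "q' (- z) \<le> - q z" using le[of 1 "- z"] sublinear_zero[OF q] by simp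
    show "sublinear q'"
    proof (rule sublinearI)
      fix x y
      have "q' (x + y) - (q (x + s *\<^sub>R z) - s * q z) \<le> q' y" if s: "0 \<le> s" for s
      proof (rule ge)
        fix t :: real assume t: "0 \<le> t"
        have "q' (x + y) \<le> q ((x + y) + (s + t) *\<^sub>R z) - (s + t) * q z"
          using s t by (intro le) simp
        also have "(x + y) + (s + t) *\<^sub>R z = (x + s *\<^sub>R z) + (y + t *\<^sub>R z)"
          by (simp add: algebra_simps)
        also have "q \<dots> \<le> q (x + s *\<^sub>R z) + q (y + t *\<^sub>R z)" by (rule sublinear_add[OF q])
        finally show "q' (x + y) - (q (x + s *\<^sub>R z) - s * q z) \<le> q (y + t *\<^sub>R z) - t * q z"
          by (simp add: algebra_simps)
      qed
      then have "q' (x + y) - q' y \<le> q' x" by (intro ge) (simp add: algebra_simps)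
      then show "q' (x + y) \<le> q' x + q' y" by simp
    next
      fix c :: real and x assume c: "0 < c"
      have "inverse c * q' (c *\<^sub>R x) \<le> q' x"
      proof (rule ge)
        fix t :: real assume t: "0 \<le> t"
        have "q' (c *\<^sub>R x) \<le> q (c *\<^sub>R x + (c * t) *\<^sub>R z) - (c * t) * q z"
          using c t by (intro le) simp
        also have "c *\<^sub>R x + (c * t) *\<^sub>R z = c *\<^sub>R (x + t *\<^sub>R z)" by (simp add: algebra_simps)
        also have "q \<dots> = c * q (x + t *\<^sub>R z)" using c by (intro sublinear_scaleR[OF q]) simp
        finally show "inverse c * q' (c *\<^sub>R x) \<le> q (x + t *\<^sub>R z) - t * q z"
          using c by (simp add: field_simps)
      qed
      then show "q' (c *\<^sub>R x) \<le> c * q' x" using c by (simp add: field_simps)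
    next
      have "q' 0 \<le> 0" using le[of 0 0] sublinear_zero[OF q] by simp
      moreover have "0 \<le> q' 0" by (rule ge) (simp add: sublinear_scaleR[OF q])
      ultimately show "q' 0 = 0" by simp
    qed
  qed
qed

text \<open>Minimality absorbs the smaller functional from \<open>sublinear_lower\<close>, so m is
  odd; a sublinear odd functional is also superadditive.\<close>

lemma sublinear_minimal_linear:
  fixes m :: "'a::real_vector \<Rightarrow> real"
  assumes m: "sublinear m" and min: "\<And>q. sublinear q \<Longrightarrow> q \<le> m \<Longrightarrow> q = m"
  shows "linear m"
proof -
  have neg: "m (- z) = - m z" for z
  proof -
    obtain q where "sublinear q" "q \<le> m" "q (- z) \<le> - m z" by (rule sublinear_lower[OF m])
    then have "m (- z) \<le> - m z" using min by blast
    then show ?thesis using sublinear_ge_uminus[OF m, of z] by linarith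
  qed
  show ?thesis
  proof
    fix x y
    have "m (- x + - y) \<le> m (- x) + m (- y)" by (rule sublinear_add[OF m])
    then have "m x + m y \<le> m (x + y)" using neg[of "x + y"] by (simp add: neg)
    then show "m (x + y) = m x + m y" using sublinear_add[OF m, of x y] by simp
  next
    fix c :: real and x
    show "m (c *\<^sub>R x) = c *\<^sub>R m x"
    proof (cases "0 \<le> c")
      case False
      then have "m ((- c) *\<^sub>R x) = - c * m x" by (intro sublinear_scaleR[OF m]) simp
      then show ?thesis using neg[of "c *\<^sub>R x"] by simp
    qed (simp add: sublinear_scaleR[OF m])
  qed
qed

text \<open>Zorn's lemma with the order reversed produces a minimal sublinear functional below p,
  and minimal ones are linear. Lower bounds of chains are pointwise infima.\<close>

lemma hahn_banach_sublinear:
  fixes p :: "'a::real_vector \<Rightarrow> real"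
  assumes p: "sublinear p"
  obtains f where "linear f" "f \<le> p"
proof -
  define A where "A = {q. sublinear q \<and> q \<le> p}"
  have "\<exists>m\<in>A. \<forall>a\<in>A. a \<le> m \<longrightarrow> a = m"
  proof (rule predicate_Zorn)
    show "partial_order_on A (relation_of (\<lambda>a b. b \<le> a) A)"
      by (rule partial_order_on_relation_ofI) auto
    fix C assume C: "C \<in> Chains (relation_of (\<lambda>a b. b \<le> a) A)"
    show "\<exists>u\<in>A. \<forall>a\<in>C. u \<le> a"
    proof (cases "C = {}")
      case True then show ?thesis using p by (auto simp: A_def)
    next
      case ne: False
      have CA: "C \<subseteq> A" using C unfolding Chains_def relation_of_def by blast
      have tot: "a \<le> b \<or> b \<le> a" if "a \<in> C" "b \<in> C" for a b
        using C that unfolding Chains_def relation_of_def by blast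
      have sub: "sublinear q" "q \<le> p" if "q \<in> C" for q using CA that by (auto simp: A_def)
      define u where "u x = Inf ((\<lambda>q. q x) ` C)" for x
      have bdd: "bdd_below ((\<lambda>q. q x) ` C)" for x
      proof (rule bdd_belowI2)
        fix q assume q: "q \<in> C"
        have "- p (- x) \<le> - q (- x)" using sub(2)[OF q] by (simp add: le_fun_def)
        also have "\<dots> \<le> q x" by (rule sublinear_ge_uminus[OF sub(1)[OF q]])
        finally show "- p (- x) \<le> q x" .
      qed
      have le: "u x \<le> q x" if "q \<in> C" for q x
        unfolding u_def by (rule cInf_lower[OF _ bdd]) (use that in auto)
      have ge: "c \<le> u x" if "\<And>q. q \<in> C \<Longrightarrow> c \<le> q x" for c x
        unfolding u_def by (rule cInf_greatest) (use ne that in auto)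
      have "sublinear u"
      proof (rule sublinearI)
        fix x y
        have "u (x + y) - q y \<le> u x" if q: "q \<in> C" for q
        proof (rule ge)
          fix q' assume q': "q' \<in> C"
          \<comment> \<open>Subadditivity of the infimum needs one functional that serves both
            summands; in a chain the smaller of q and q' does.\<close>
          have "\<exists>r\<in>C. r \<le> q \<and> r \<le> q'" using tot[OF q q'] q q' by blast
          then obtain r where r: "r \<in> C" "r \<le> q" "r \<le> q'" by blast
          have "u (x + y) \<le> r (x + y)" by (rule le[OF r(1)])
          also have "\<dots> \<le> r x + r y" by (rule sublinear_add[OF sub(1)[OF r(1)]])
          also have "\<dots> \<le> q' x + q y" using r by (intro add_mono) (simp_all add: le_fun_def)
          finally show "u (x + y) - q y \<le> q' x" by simp
        qed
        then have "u (x + y) - u x \<le> u y" by (intro ge) (simp add: algebra_simps)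
        then show "u (x + y) \<le> u x + u y" by simp
      next
        fix c :: real and x assume c: "0 < c"
        have "inverse c * u (c *\<^sub>R x) \<le> u x"
        proof (rule ge)
          fix q assume q: "q \<in> C"
          have "u (c *\<^sub>R x) \<le> c * q x"
            using le[OF q, of "c *\<^sub>R x"] sublinear_scaleR[OF sub(1)[OF q], of c x] c by simp
          then show "inverse c * u (c *\<^sub>R x) \<le> q x" using c by (simp add: field_simps)
        qed
        then show "u (c *\<^sub>R x) \<le> c * u x" using c by (simp add: field_simps)
      next
        have "q 0 = 0" if "q \<in> C" for q by (rule sublinear_zero[OF sub(1)[OF that]])
        then have "(\<lambda>q. q 0) ` C = {0}" using ne by (force simp: image_iff)
        then show "u 0 = 0" by (simp add: u_def)
      qed
      moreover have "u \<le> p"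
      proof -
        obtain q where "q \<in> C" using ne by blast
        then show ?thesis using le sub(2) by (meson le_funI le_funD order_trans)
      qed
      ultimately show ?thesis using le by (auto simp: A_def le_fun_def)
    qed
  qed
  then obtain m where m: "m \<in> A" "\<And>a. a \<in> A \<Longrightarrow> a \<le> m \<Longrightarrow> a = m" by blast
  have "linear m"
  proof (rule sublinear_minimal_linear)
    show "sublinear m" using m by (simp add: A_def)
    show "q = m" if "sublinear q" "q \<le> m" for q
      using that m by (auto simp: A_def intro: order_trans)
  qed
  then show ?thesis using m that by (simp add: A_def)
qed

section \<open>Positive functionals\<close>

text \<open>The norm of the positive part replaces the norm as sublinear bound: it vanishes at - x
  for x >= 0, which forces positivity. Lowering it at - y to at most - p y first forces the value at
  y up to \<open>norm y\<close>.\<close>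

lemma positive_norming_functional:
  fixes y :: "'a::banach_lattice"
  assumes "0 \<le> y"
  obtains f :: "'a \<Rightarrow>\<^sub>L real" where "0 \<le> f" "norm f \<le> 1" "blinfun_apply f y = norm y"
proof -
  define p where "p x = norm (pprt x)" for x :: 'a
  have "sublinear p"
  proof (rule sublinearI)
    fix a b :: 'a
    have "a + b \<le> pprt a + pprt b" by (intro add_mono) (simp_all add: pprt_def)
    then have "pprt (a + b) \<le> pprt a + pprt b" by (simp add: pprt_def[of "a + b"])
    then have "norm (pprt (a + b)) \<le> norm (pprt a + pprt b)" by (intro norm_mono_nonneg) simp_all
    also have "\<dots> \<le> norm (pprt a) + norm (pprt b)" by (rule norm_triangle_ineq)
    finally show "p (a + b) \<le> p a + p b" by (simp add: p_def)
  next
    fix c :: real and a :: 'a assume c: "0 < c"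
    have "c *\<^sub>R a \<le> c *\<^sub>R pprt a" using c by (intro scaleR_left_mono) (simp_all add: pprt_def)
    then have "pprt (c *\<^sub>R a) \<le> c *\<^sub>R pprt a"
      using c by (simp add: pprt_def[of "c *\<^sub>R a"] scaleR_nonneg_nonneg)
    then have "norm (pprt (c *\<^sub>R a)) \<le> norm (c *\<^sub>R pprt a)" by (intro norm_mono_nonneg) simp_all
    then show "p (c *\<^sub>R a) \<le> c * p a" using c by (simp add: p_def)
  qed (simp add: p_def)
  then obtain q where q: "sublinear q" "q \<le> p" "q (- y) \<le> - p y" by (rule sublinear_lower)
  obtain f where f: "linear f" "f \<le> q" using hahn_banach_sublinear[OF q(1)] by blast
  have fp: "f x \<le> p x" for x using f(2) q(2) by (meson le_funD order_trans)
  have neg: "f (- x) = - f x" for x by (rule linear_neg[OF f(1)])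
  have bnd: "\<bar>f x\<bar> \<le> norm x" for x
    using fp[of x] fp[of "- x"] norm_pprt_le[of x] norm_pprt_le[of "- x"]
    by (auto simp: p_def neg)
  have bl: "bounded_linear f"
    using bnd f(1) by (intro bounded_linear_intro[where K = 1]) (auto simp: linear_add linear_scale)
  have app: "blinfun_apply (Blinfun f) = f" by (rule bounded_linear_Blinfun_apply[OF bl])
  show ?thesis
  proof
    show "0 \<le> Blinfun f"
      unfolding less_eq_blinfun_def app
    proof (intro allI impI)
      fix x :: 'a assume "0 \<le> x"
      then show "blinfun_apply 0 x \<le> f x" using fp[of "- x"] by (simp add: p_def neg)
    qed
    show "norm (Blinfun f) \<le> 1" by (rule norm_blinfun_bound) (use bnd in \<open>simp_all add: app\<close>)
    have "p y \<le> f y" using le_funD[OF f(2), of "- y"] q(3) by (simp add: neg)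
    then show "blinfun_apply (Blinfun f) y = norm y"
      using fp[of y] assms by (simp add: app p_def)
  qed
qed

lemma blinfun_nonneg: "0 \<le> f \<Longrightarrow> 0 \<le> x \<Longrightarrow> 0 \<le> blinfun_apply f x"
  for f :: "'a::banach_lattice \<Rightarrow>\<^sub>L real"
  by (auto simp: less_eq_blinfun_def)

lemma blinfun_mono: "0 \<le> f \<Longrightarrow> x \<le> y \<Longrightarrow> blinfun_apply f x \<le> blinfun_apply f y"
  for f :: "'a::banach_lattice \<Rightarrow>\<^sub>L real"
  using blinfun_nonneg[of f "y - x"] by (simp add: blinfun.diff_right)

text \<open>A weighted sum of norming functionals vanishes on the limit superior of a summable
  subsequence, which is therefore also annihilated by each of them.\<close>

lemma order_continuous_norm_weak_to_norm:
  fixes y :: "nat \<Rightarrow> 'a::banach_lattice"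
  assumes oc: "order_continuous_norm TYPE('a)" and y: "\<And>n. 0 \<le> y n" "\<And>n. y n \<le> w"
    and weak: "\<And>f :: 'a \<Rightarrow>\<^sub>L real. 0 \<le> f \<Longrightarrow> (\<lambda>n. blinfun_apply f (y n)) \<longlonglongrightarrow> 0"
  shows "y \<longlonglongrightarrow> 0"
proof (rule ccontr)
  assume "\<not> y \<longlonglongrightarrow> 0"
  then obtain e where e: "0 < e" "\<And>N. \<exists>n\<ge>N. e \<le> norm (y n)"
    unfolding LIMSEQ_iff by (auto simp: not_less)
  have "\<forall>n. \<exists>f::'a \<Rightarrow>\<^sub>L real. 0 \<le> f \<and> norm f \<le> 1 \<and> blinfun_apply f (y n) = norm (y n)"
    using positive_norming_functional y(1) by metis
  then obtain F :: "nat \<Rightarrow> 'a \<Rightarrow>\<^sub>L real" where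
    F: "\<And>n. 0 \<le> F n" "\<And>n. norm (F n) \<le> 1" "\<And>n. blinfun_apply (F n) (y n) = norm (y n)" by metis
  \<comment> \<open>Any positive weights with finite sum would serve: the series converges in the
    dual, and g dominates a positive multiple of each \<open>F n\<close>.\<close>
  define G where "G n = (1/2) ^ n *\<^sub>R F n" for n
  have sumG: "summable G"
  proof (rule summable_comparison_test')
    show "norm (G n) \<le> (1/2) ^ n" for n using F(2)[of n] by (simp add: G_def mult_left_le)
    show "summable (\<lambda>n. (1/2::real) ^ n)" by (rule summable_geometric) simp
  qed
  define g where "g = suminf G"
  have gx: "(\<lambda>n. (1/2) ^ n * blinfun_apply (F n) x) sums blinfun_apply g x" for x
    using bounded_linear.sums[OF blinfun.bounded_linear_left[of x] summable_sums[OF sumG]]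
    by (simp add: G_def g_def blinfun.scaleR_left)
  have g_ge: "(1/2) ^ n * blinfun_apply (F n) x \<le> blinfun_apply g x" if "0 \<le> x" for n x
    using sum_le_suminf[OF sums_summable[OF gx[of x]], of "{n}"] sums_unique[OF gx[of x]]
      blinfun_nonneg[OF F(1) that] by simp
  have g0: "0 \<le> g"
    unfolding less_eq_blinfun_def
  proof (intro allI impI)
    fix x :: 'a assume x: "0 \<le> x"
    show "blinfun_apply 0 x \<le> blinfun_apply g x"
      using g_ge[OF x, of 0] blinfun_nonneg[OF F(1)[of 0] x] by simp
  qed
  \<comment> \<open>The subsequence is thinned until its values under g are summable, so that
    suprema of tails still have small values under g.\<close>
  have "\<exists>n>k. e \<le> norm (y n) \<and> blinfun_apply g (y n) < (1/2) ^ k" for k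
  proof -
    obtain N where N: "\<And>n. N \<le> n \<Longrightarrow> \<bar>blinfun_apply g (y n)\<bar> < (1/2) ^ k"
      using LIMSEQ_D[OF weak[OF g0], of "(1/2) ^ k"] by auto
    obtain n where "max N (Suc k) \<le> n" "e \<le> norm (y n)" using e(2) by blast
    then show ?thesis using N[of n] by (intro exI[of _ n]) auto
  qed
  then obtain \<sigma> where \<sigma>: "\<And>k. e \<le> norm (y (\<sigma> k))" "\<And>k. blinfun_apply g (y (\<sigma> k)) < (1/2) ^ k"
    by metis
  \<comment> \<open>The supremum of the N + 1 terms with indices m, ..., m + N of the subsequence;
    its limit \<open>q m\<close> in N is the supremum of the whole tail.\<close>
  define s where "s m N = rec_nat (y (\<sigma> m)) (\<lambda>i a. sup a (y (\<sigma> (m + Suc i)))) N" for m N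
  have s0: "s m 0 = y (\<sigma> m)" and sS: "s m (Suc N) = sup (s m N) (y (\<sigma> (m + Suc N)))" for m N
    by (simp_all add: s_def)
  have s_ub: "y (\<sigma> (m + i)) \<le> s m N" if "i \<le> N" for m i N
    using that
  proof (induction N)
    case (Suc N)
    then show ?case by (cases "i = Suc N") (auto simp: sS intro: le_supI1)
  qed (simp add: s0)
  have s_least: "s m N \<le> z" if "\<And>i. i \<le> N \<Longrightarrow> y (\<sigma> (m + i)) \<le> z" for m N z
    using that
  proof (induction N)
    case (Suc N)
    then show ?case using Suc.prems[of "Suc N"] by (simp add: sS)
  qed (use s0 in simp)
  have s_inc: "incseq (s m)" for m by (rule incseq_SucI) (simp add: sS)
  have s_nonneg: "0 \<le> s m N" for m N using s_ub[of 0 N m] y(1) order_trans by (metis le0)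
  have s_w: "s m N \<le> w" for m N by (rule s_least) (rule y(2))
  have s_g: "blinfun_apply g (s m N) \<le> (\<Sum>i\<le>N. blinfun_apply g (y (\<sigma> (m + i))))" for m N
  proof (induction N)
    case (Suc N)
    have "s m (Suc N) \<le> s m N + y (\<sigma> (m + Suc N))"
      using s_nonneg y(1) by (simp add: sS)
    then have "blinfun_apply g (s m (Suc N)) \<le> blinfun_apply g (s m N) + blinfun_apply g (y (\<sigma> (m + Suc N)))"
      using blinfun_mono[OF g0] by (simp flip: blinfun.add_right)
    then show ?case using Suc by simp
  qed (simp add: s0)
  have s_g': "blinfun_apply g (s m N) \<le> 2 * (1/2) ^ m" for m N
  proof -
    have "blinfun_apply g (s m N) \<le> (\<Sum>i\<le>N. (1/2) ^ m * (1/2) ^ i)"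
      using s_g[of m N] \<sigma>(2) by (intro order_trans[OF s_g] sum_mono) (simp add: less_imp_le flip: power_add)
    also have "\<dots> = (1/2) ^ m * (\<Sum>i\<le>N. (1/2) ^ i)" by (simp add: sum_distrib_left)
    also have "(\<Sum>i\<le>N. (1/2::real) ^ i) \<le> 2"
      using sum_le_suminf[of "\<lambda>i. (1/2::real) ^ i" "{..N}"] by (simp add: suminf_geometric)
    finally show ?thesis by (simp add: mult.commute)
  qed
  have "convergent (s m)" for m
    by (rule order_continuous_norm_incseq_convergent[OF oc s_inc s_w])
  then obtain q where q: "\<And>m. s m \<longlonglongrightarrow> q m" unfolding convergent_def by metis
  have qs: "s m N \<le> q m" for m N by (rule incseq_lim_upper[OF s_inc q])
  have q_least: "q m \<le> z" if "\<And>i. y (\<sigma> (m + i)) \<le> z" for m z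
    by (rule lim_le_banach_lattice[OF q]) (auto intro: s_least that)
  have yq: "y (\<sigma> (m + i)) \<le> q m" for m i using s_ub[of i i m] qs[of m i] by simp
  have q_dec: "q (Suc m) \<le> q m" for m
    by (rule q_least) (use yq[of m "Suc i" for i] in simp)
  have q_nonneg: "0 \<le> q m" for m using s_nonneg[of m 0] qs[of m 0] by simp
  have q_g: "blinfun_apply g (q m) \<le> 2 * (1/2) ^ m" for m
  proof (rule LIMSEQ_le_const2)
    show "(\<lambda>N. blinfun_apply g (s m N)) \<longlonglongrightarrow> blinfun_apply g (q m)"
      by (intro tendsto_intros q)
  qed (use s_g' in blast)
  \<comment> \<open>The tail suprema decrease, whereas the convergence lemma is about increasing
    sequences; hence the reflection at w. The limit w - r of q is the limit superior.\<close>
  have "convergent (\<lambda>m. w - q m)"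
    by (rule order_continuous_norm_incseq_convergent[OF oc, of _ w])
      (use q_dec q_nonneg in \<open>auto intro!: incseq_SucI diff_left_mono\<close>)
  then obtain r where r: "(\<lambda>m. w - q m) \<longlonglongrightarrow> r" by (auto simp: convergent_def)
  have ql: "q \<longlonglongrightarrow> w - r"
    using tendsto_diff[OF tendsto_const[of w] r] by simp
  have wr_nonneg: "0 \<le> w - r"
    by (rule tendsto_le_banach_lattice[OF tendsto_const ql]) (use q_nonneg in auto)
  have "blinfun_apply g (w - r) \<le> 0"
  proof (rule LIMSEQ_le)
    show "(\<lambda>m. blinfun_apply g (q m)) \<longlonglongrightarrow> blinfun_apply g (w - r)"
      by (intro tendsto_intros ql)
    have "(\<lambda>m. (1/2::real) ^ m) \<longlonglongrightarrow> 0" by (rule LIMSEQ_realpow_zero) auto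
    from tendsto_mult[OF tendsto_const[of 2] this]
    show "(\<lambda>m. 2 * (1/2::real) ^ m) \<longlonglongrightarrow> 0" by simp
  qed (use q_g in blast)
  then have F0: "blinfun_apply (F n) (w - r) \<le> 0" for n
  proof -
    have "(1/2) ^ n * blinfun_apply (F n) (w - r) \<le> 0"
      using g_ge[OF wr_nonneg, of n] \<open>blinfun_apply g (w - r) \<le> 0\<close> by linarith
    moreover have "(0::real) < (1/2) ^ n" by simp
    ultimately show ?thesis by (metis mult_le_0_iff not_le)
  qed
  obtain m where m: "norm (q m - (w - r)) < e" using LIMSEQ_D[OF ql e(1)] by blast
  define n where "n = \<sigma> m"
  have "e \<le> blinfun_apply (F n) (y n)" using \<sigma>(1) F(3) by (simp add: n_def)
  also have "\<dots> \<le> blinfun_apply (F n) (q m)"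
    using yq[of m 0] by (intro blinfun_mono F(1)) (simp add: n_def)
  also have "\<dots> \<le> blinfun_apply (F n) (q m - (w - r))"
    using F0[of n] by (simp add: blinfun.diff_right)
  also have "\<dots> \<le> norm (F n) * norm (q m - (w - r))"
    using norm_blinfun[of "F n" "q m - (w - r)"] by simp
  also have "\<dots> \<le> 1 * norm (q m - (w - r))" by (intro mult_right_mono F(2)) simp
  finally show False using m by simp
qed

section \<open>Disjoint sequences\<close>

text \<open>A sliding hump argument: otherwise some subset \<open>A\<close> of the indices has humps that the
  remainder of \<open>A\<close> cannot compensate.\<close>

lemma phillips_diagonal:
  fixes \<nu> :: "nat \<Rightarrow> nat set \<Rightarrow> 'b::real_normed_vector" and l :: "nat \<Rightarrow> nat set \<Rightarrow> real"
  assumes add: "\<And>n A B. A \<inter> B = {} \<Longrightarrow> \<nu> n (A \<union> B) = \<nu> n A + \<nu> n B"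
    and le: "\<And>n A. norm (\<nu> n A) \<le> l n A"
    and mono: "\<And>n A B. A \<subseteq> B \<Longrightarrow> l n A \<le> l n B"
    and dis: "\<And>n (A :: nat \<Rightarrow> nat set). disjoint_family A \<Longrightarrow> (\<lambda>i. l n (A i)) \<longlonglongrightarrow> 0"
    and lim: "\<And>A. (\<lambda>n. \<nu> n A) \<longlonglongrightarrow> 0"
  shows "(\<lambda>n. \<nu> n {n}) \<longlonglongrightarrow> 0"
proof (rule ccontr)
  assume "\<not> (\<lambda>n. \<nu> n {n}) \<longlonglongrightarrow> 0"
  then obtain e where e: "0 < e" "\<And>N. \<exists>n\<ge>N. e \<le> norm (\<nu> n {n})"
    unfolding LIMSEQ_iff by (auto simp: not_less)
  define N0 where "N0 = {n. e \<le> norm (\<nu> n {n})}"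
  have N0: "infinite N0" using e(2) by (auto simp: N0_def infinite_nat_iff_unbounded_le)
  \<comment> \<open>A pairing function cuts N into infinitely many disjoint infinite sets;
    exhaustivity makes one of them small for l n.\<close>
  have split: "\<exists>N'\<subseteq>N. infinite N' \<and> l n N' < e / 4" if N: "infinite N" for N n
  proof -
    obtain f :: "nat \<Rightarrow> nat" where f: "inj f" "range f \<subseteq> N"
      using infinite_countable_subset[OF N] by blast
    define A where "A i = range (\<lambda>j. f (prod_encode (i, j)))" for i
    have "disjoint_family A"
      unfolding disjoint_family_on_def A_def by (auto dest!: injD[OF f(1)] simp: prod_encode_eq)
    from LIMSEQ_D[OF dis[OF this, of n], of "e / 4"] e(1)
    obtain i where "\<bar>l n (A i)\<bar> < e / 4" by auto
    moreover have "infinite (A i)"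
      unfolding A_def by (intro range_inj_infinite injI) (auto dest!: injD[OF f(1)] simp: prod_encode_eq)
    moreover have "A i \<subseteq> N" using f(2) by (auto simp: A_def)
    ultimately show ?thesis by (intro exI[of _ "A i"]) auto
  qed
  have step: "\<exists>k N'. k \<in> N \<and> infinite N' \<and> N' \<subseteq> N \<inter> {k<..} \<and> norm (\<nu> k F) < e / 4 \<and> l k N' < e / 4"
    if N: "infinite N" for N F
  proof -
    obtain m where m: "\<And>n. m \<le> n \<Longrightarrow> norm (\<nu> n F) < e / 4"
      using LIMSEQ_D[OF lim[of F], of "e / 4"] e(1) by auto
    obtain k where k: "k \<in> N" "m \<le> k" using N by (auto simp: infinite_nat_iff_unbounded_le)
    have "infinite (N - {..k})" using N by simp
    then obtain N' where "N' \<subseteq> N - {..k}" "infinite N'" "l k N' < e / 4" using split by blast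
    then show ?thesis using k m[of k] by (intro exI[of _ k] exI[of _ N']) auto
  qed
  \<comment> \<open>A state consists of the humps F chosen so far, the current hump k, and a
    reservoir N for all later ones. Past and future are both small at k: F through the choice of k,
    N through \<open>split\<close>.\<close>
  define P where "P = (\<lambda>i::nat. \<lambda>(F, k, N). (i = 0 \<longrightarrow> F = {}) \<and> (\<forall>x\<in>F. x < k) \<and> k \<in> N0 \<and> infinite N
      \<and> N \<subseteq> N0 \<inter> {k<..} \<and> norm (\<nu> k F) < e / 4 \<and> l k N < e / 4)"
  define Q where "Q = (\<lambda>i::nat. \<lambda>(F, k::nat, N) (F', k', N' :: nat set). F' = insert k F \<and> k' \<in> N \<and> N' \<subseteq> N)"
  have "\<exists>f. \<forall>i. P i (f i) \<and> Q i (f i) (f (Suc i))"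
  proof (rule dependent_nat_choice)
    obtain k N' where "k \<in> N0" "infinite N'" "N' \<subseteq> N0 \<inter> {k<..}" "norm (\<nu> k {}) < e / 4" "l k N' < e / 4"
      using step[OF N0] by blast
    then have "P 0 ({}, k, N')" by (simp add: P_def)
    then show "\<exists>s. P 0 s" ..
    fix s i assume s: "P i s"
    obtain F k N where s': "s = (F, k, N)" by (cases s)
    have N: "infinite N" using s by (simp add: s' P_def)
    obtain k' N' where k': "k' \<in> N" "infinite N'" "N' \<subseteq> N \<inter> {k'<..}"
      "norm (\<nu> k' (insert k F)) < e / 4" "l k' N' < e / 4"
      using step[OF N, of "insert k F"] by blast
    then have "P (Suc i) (insert k F, k', N') \<and> Q i s (insert k F, k', N')"
      using s by (fastforce simp: s' P_def Q_def)
    then show "\<exists>t. P (Suc i) t \<and> Q i s t" ..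
  qed
  then obtain f where f: "\<And>i. P i (f i)" "\<And>i. Q i (f i) (f (Suc i))" by blast
  define F where "F i = fst (f i)" for i
  define k where "k i = fst (snd (f i))" for i
  define N where "N i = snd (snd (f i))" for i
  have feq: "f i = (F i, k i, N i)" for i by (simp add: F_def k_def N_def)
  have P: "i = 0 \<Longrightarrow> F i = {}" "\<And>x. x \<in> F i \<Longrightarrow> x < k i" "k i \<in> N0" "N i \<subseteq> {k i<..}"
    "norm (\<nu> (k i) (F i)) < e / 4" "l (k i) (N i) < e / 4" for i
    using f(1)[of i] by (auto simp: feq P_def)
  have Q: "F (Suc i) = insert (k i) (F i)" "k (Suc i) \<in> N i" "N (Suc i) \<subseteq> N i" for i
    using f(2)[of i] by (auto simp: feq Q_def)
  have smono: "strict_mono k" unfolding strict_mono_Suc_iff using P(4) Q(2) by blast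
  have F: "F i = k ` {..<i}" for i
    by (induction i) (auto simp: P(1) Q(1) lessThan_Suc)
  have Ndec: "N j \<subseteq> N i" if "i \<le> j" for i j using that lift_Suc_antimono_le[of N] Q(3) by blast
  define A where "A = range k"
  \<comment> \<open>A consists of earlier humps, the hump k i and later ones inside N i. The
    singleton contributes at least e and the other two parts less than e/4 each, leaving
    e/2.\<close>
  have big: "e / 2 \<le> norm (\<nu> (k i) A)" for i
  proof -
    define R where "R = k ` {i<..}"
    have "R \<subseteq> N i"
    proof
      fix x assume "x \<in> R"
      then obtain j where j: "i < j" "x = k j" by (auto simp: R_def)
      then obtain j' where "j = Suc j'" "i \<le> j'" by (cases j) auto
      then show "x \<in> N i" using Q(2)[of j'] Ndec[of i j'] j by blast
    qed
    then have "l (k i) R < e / 4" using mono[of R "N i" "k i"] P(6)[of i] by simp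
    then have R: "norm (\<nu> (k i) R) < e / 4" using le[of "k i" R] by simp
    have inj: "inj k" using smono by (rule strict_mono_imp_inj_on)
    have U: "UNIV = {..<i} \<union> ({i} \<union> {i<..})" by auto
    have A: "A = F i \<union> ({k i} \<union> R)"
      unfolding A_def F R_def by (subst U) (auto simp: image_Un)
    have "F i \<inter> ({k i} \<union> R) = {}" "{k i} \<inter> R = {}"
      by (auto simp: F R_def dest!: injD[OF inj])
    then have eq: "\<nu> (k i) A = \<nu> (k i) (F i) + (\<nu> (k i) {k i} + \<nu> (k i) R)"
      unfolding A by (simp only: add)
    have "norm (\<nu> (k i) {k i}) \<le> norm (\<nu> (k i) A) + norm (\<nu> (k i) (F i)) + norm (\<nu> (k i) R)"
    proof -
      have "\<nu> (k i) {k i} = \<nu> (k i) A - \<nu> (k i) (F i) - \<nu> (k i) R" using eq by simp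
      then show ?thesis
        using norm_triangle_ineq4[of "\<nu> (k i) A - \<nu> (k i) (F i)" "\<nu> (k i) R"]
          norm_triangle_ineq4[of "\<nu> (k i) A" "\<nu> (k i) (F i)"] by simp
    qed
    moreover have "e \<le> norm (\<nu> (k i) {k i})" using P(3)[of i] by (simp add: N0_def)
    ultimately show ?thesis using R P(5)[of i] by linarith
  qed
  have "(\<lambda>i. \<nu> (k i) A) \<longlonglongrightarrow> 0"
    using LIMSEQ_subseq_LIMSEQ[OF lim[of A] smono] by (simp add: o_def)
  then obtain i where "norm (\<nu> (k i) A) < e / 2"
    using LIMSEQ_D[of _ 0 "e / 2"] e(1) by fastforce
  then show False using big[of i] by simp
qed

text \<open>\<open>phillips_diagonal\<close> is applied to the images under T of the components of y
  n in the bands generated by subsets of the w i. At the singleton {n} the projection kills the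
  negative part of y n and fixes w n, so T (w n) lies below the diagonal term.\<close>

lemma disjoint_dominated_null:
  fixes T :: "'a::banach_lattice \<Rightarrow> 'b::banach_lattice" and y w :: "nat \<Rightarrow> 'a"
  assumes ppp: "principal_projection_property TYPE('a)" and oc: "order_continuous_norm TYPE('b)"
    and T: "positive_operator T" and bnd: "bounded (range y)"
    and null: "\<And>P. central P \<Longrightarrow> (\<lambda>n. T (P (y n))) \<longlonglongrightarrow> 0"
    and w: "\<And>n. 0 \<le> w n" "\<And>n. w n \<le> pprt (y n)" "\<And>m n. m \<noteq> n \<Longrightarrow> lat_disj (w m) (w n)"
  shows "(\<lambda>n. T (w n)) \<longlonglongrightarrow> 0"
proof -
  have linT: "linear T" using T by (simp add: positive_operator_def)
  obtain K where K: "\<And>n. norm (y n) \<le> K" using bnd by (auto simp: bounded_iff)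
  \<comment> \<open>Bounded norms and the weights 1/2^n make the sum converge, so even an infinite A
    has one generating element \<open>wA A\<close>. Scaling does not affect the band.\<close>
  define W where "W A n = (if n \<in> A then (1/2) ^ n else 0) *\<^sub>R w n" for A n
  define wA where "wA A = suminf (W A)" for A
  have normw: "norm (w n) \<le> K" for n
    using norm_mono_nonneg[OF w(1,2), of n] norm_pprt_le[of "y n"] K[of n] by linarith
  have "0 \<le> K" using normw[of 0] norm_ge_zero[of "w 0"] by linarith
  have sumW: "summable (W A)" for A
  proof (rule summable_comparison_test')
    show "norm (W A n) \<le> (1/2) ^ n * K" for n
      using normw[of n] \<open>0 \<le> K\<close> by (simp add: W_def mult_left_mono)
    show "summable (\<lambda>n. (1/2::real) ^ n * K)" by (intro summable_mult2 summable_geometric) simp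
  qed
  have W0: "0 \<le> W A n" for A n using w(1) by (simp add: W_def scaleR_nonneg_nonneg)
  have lim: "(\<lambda>n. \<Sum>i<n. W A i) \<longlonglongrightarrow> wA A" for A
    using summable_LIMSEQ[OF sumW] by (simp add: wA_def)
  have wA0: "0 \<le> wA A" for A
    by (rule tendsto_le_banach_lattice[OF tendsto_const lim]) (auto intro!: always_eventually sum_nonneg W0)
  have disj_wA: "lat_disj (wA A) v" if "\<And>n. n \<in> A \<Longrightarrow> lat_disj (w n) v" for A v
  proof (rule lat_disj_tendsto[OF lim])
    show "lat_disj (\<Sum>i<n. W A i) v" for n
      by (induction n) (auto intro!: lat_disj_add lat_disj_scaleR that simp: W_def)
  qed
  have disjAB: "lat_disj (wA A) (wA B)" if AB: "A \<inter> B = {}" for A B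
  proof (rule disj_wA)
    fix n assume n: "n \<in> A"
    have "lat_disj (wA B) (w n)"
    proof (rule disj_wA)
      fix m assume "m \<in> B"
      then have "m \<noteq> n" using n AB by auto
      then show "lat_disj (w m) (w n)" by (rule w(3))
    qed
    then show "lat_disj (w n) (wA B)" by (simp add: lat_disj_commute)
  qed
  define b where "b A = band_proj (wA A)" for A
  have cb: "central (b A)" for A using central_band_proj[OF ppp wA0] by (simp add: b_def)
  have b_add: "b (A \<union> B) x = b A x + b B x" if "A \<inter> B = {}" for A B x
  proof -
    have "W (A \<union> B) = (\<lambda>n. W A n + W B n)"
      using that by (intro ext) (auto simp: W_def)
    then have "wA (A \<union> B) = wA A + wA B"
      using suminf_add[OF sumW sumW, of A B] by (simp add: wA_def)
    then show ?thesis using band_proj_add[OF ppp wA0 wA0 disjAB[OF that]] by (simp add: b_def)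
  qed
  define \<nu> where "\<nu> n A = T (b A (y n))" for n A
  \<comment> \<open>The modulus of y n makes l monotone in A, which need not hold for the norm of
    \<open>\<nu> n A\<close>.\<close>
  define l where "l n A = norm (T (b A \<bar>y n\<bar>))" for n A
  have Tb0: "0 \<le> T (b A \<bar>x\<bar>)" for A x
    using T central_nonneg[OF cb, of "\<bar>x\<bar>"] by (simp add: positive_operator_def)
  have "(\<lambda>n. \<nu> n {n}) \<longlonglongrightarrow> 0"
  proof (rule phillips_diagonal[where l = l])
    show "\<nu> n (A \<union> B) = \<nu> n A + \<nu> n B" if "A \<inter> B = {}" for n A B
      by (simp add: \<nu>_def b_add[OF that] linear_add[OF linT])
    show "norm (\<nu> n A) \<le> l n A" for n A
      unfolding \<nu>_def l_def
      by (rule norm_mono_abs)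
        (use positive_abs[OF T positive_abs[OF central_positive[OF cb] order_refl]] Tb0 in simp)
    show "l n A \<le> l n B" if "A \<subseteq> B" for n A B
    proof -
      have "B = A \<union> (B - A)" using that by blast
      then have "b B \<bar>y n\<bar> = b A \<bar>y n\<bar> + b (B - A) \<bar>y n\<bar>"
        using b_add[of A "B - A"] by auto
      then have "b A \<bar>y n\<bar> \<le> b B \<bar>y n\<bar>" using central_nonneg[OF cb] by simp
      then show ?thesis unfolding l_def by (intro norm_mono_nonneg Tb0 positive_mono[OF T])
    qed
    show "(\<lambda>n. \<nu> n A) \<longlonglongrightarrow> 0" for A unfolding \<nu>_def by (rule null[OF cb])
    fix n and A :: "nat \<Rightarrow> nat set" assume A: "disjoint_family A"
    \<comment> \<open>At m = 0 the equation would require b to vanish at the empty set; the disjunct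
      sets that case aside.\<close>
    have "(\<Sum>i<m. T (b (A i) \<bar>y n\<bar>)) = T (b (\<Union>i<m. A i) \<bar>y n\<bar>) \<or> m = 0" for m
    proof (induction m)
      case (Suc m)
      show ?case
      proof (cases "m = 0")
        case False
        have "A m \<inter> A i = {}" if "i < m" for i
          using that by (intro disjoint_family_onD[OF A]) simp_all
        then have "A m \<inter> (\<Union>i<m. A i) = {}" by auto
        from b_add[OF this] show ?thesis
          using Suc False by (simp add: lessThan_Suc linear_add[OF linT])
      qed (simp add: lessThan_Suc)
    qed simp
    moreover have "T (b B \<bar>y n\<bar>) \<le> T \<bar>y n\<bar>" for B
      by (intro positive_mono[OF T] central_le[OF cb]) simp
    moreover have "0 \<le> T \<bar>y n\<bar>" using T by (simp add: positive_operator_def)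
    ultimately have "(\<Sum>i<m. T (b (A i) \<bar>y n\<bar>)) \<le> T \<bar>y n\<bar>" for m
      by (cases "m = 0") (simp, metis)
    then have "(\<lambda>i. T (b (A i) \<bar>y n\<bar>)) \<longlonglongrightarrow> 0"
      by (intro order_continuous_norm_bounded_sums[OF oc] Tb0)
    then show "(\<lambda>i. l n (A i)) \<longlonglongrightarrow> 0" unfolding l_def by (rule tendsto_norm_zero)
  qed
  moreover have "norm (T (w n)) \<le> norm (\<nu> n {n})" for n
  proof (rule norm_mono_nonneg)
    show "0 \<le> T (w n)" using T w(1) by (simp add: positive_operator_def)
    have wn: "wA {n} = (1/2) ^ n *\<^sub>R w n"
      using suminf_finite[of "{n}" "W {n}"] by (simp add: wA_def W_def)
    have lb: "linear (b {n})" by (rule central_linear[OF cb])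
    have "b {n} (wA {n}) = wA {n}"
      unfolding b_def by (rule band_proj_ident[OF ppp wA0]) (simp add: wA0)
    then have bw: "b {n} (w n) = w n" by (simp add: wn linear_scale[OF lb])
    have "lat_disj (pprt (- y n)) (w n)"
      using lat_disj_pprt[of "y n"] w(1,2)[of n] lat_disj_le2I[of "pprt (y n)" "pprt (- y n)" "w n" "pprt (- y n)"]
      by (simp add: lat_disj_commute)
    then have "lat_disj (pprt (- y n)) (wA {n})" unfolding wn lat_disj_commute[of "pprt (- y n)"] by (rule lat_disj_scaleR)
    then have "b {n} (pprt (- y n)) = 0" unfolding b_def by (rule band_proj_disj[OF ppp wA0])
    then have "b {n} (y n) = b {n} (pprt (y n))"
      using linear_diff[OF lb, of "pprt (y n)" "pprt (- y n)"] pprt_decomp[of "y n"] by simp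
    moreover have "b {n} (w n) \<le> b {n} (pprt (y n))"
      by (rule positive_mono[OF central_positive[OF cb] w(2)])
    ultimately show "T (w n) \<le> \<nu> n {n}"
      unfolding \<nu>_def by (intro positive_mono[OF T]) (simp add: bw)
  qed
  ultimately show ?thesis
    using Lim_null_comparison[of "\<lambda>n. T (w n)" "\<lambda>n. norm (\<nu> n {n})" sequentially]
    by (simp add: tendsto_norm_zero)
qed

text \<open>If no u works, the failure at u = 4^j times a sum of earlier terms selects a subsequence
  b whose remainders above U j stay large under T. Removing a further 2^-j z makes the remainders
  disjoint, and \<open>disjoint_dominated_null\<close> makes them small under T; the correction 2^-j
  T z vanishes too.\<close>

lemma almost_order_bounded:
  fixes T :: "'a::banach_lattice \<Rightarrow> 'b::banach_lattice" and x :: "nat \<Rightarrow> 'a"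
  assumes ppp: "principal_projection_property TYPE('a)" and oc: "order_continuous_norm TYPE('b)"
    and T: "positive_operator T" and bnd: "bounded (range x)"
    and null: "\<And>P. central P \<Longrightarrow> (\<lambda>n. T (P (x n))) \<longlonglongrightarrow> 0"
    and e: "0 < e"
  shows "\<exists>u\<ge>0. \<forall>n. norm (T (pprt (pprt (x n) - u))) \<le> e"
proof (rule ccontr)
  assume neg: "\<not> ?thesis"
  define a where "a n = pprt (x n)" for n
  have linT: "linear T" using T by (simp add: positive_operator_def)
  have a0: "0 \<le> a n" for n by (simp add: a_def)
  have "\<exists>k. e < norm (T (pprt (a k - 4 ^ j *\<^sub>R (\<Sum>i<m. a i))))" for j m :: nat
  proof -
    have "0 \<le> (4::real) ^ j *\<^sub>R (\<Sum>i<m. a i)"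
      by (intro scaleR_nonneg_nonneg sum_nonneg a0) simp
    then show ?thesis using neg by (auto simp: a_def not_le)
  qed
  then obtain \<kappa> where \<kappa>: "\<And>j m. e < norm (T (pprt (a (\<kappa> j m) - 4 ^ j *\<^sub>R (\<Sum>i<m. a i))))"
    by metis
  define k where "k = rec_nat (\<kappa> 0 0) (\<lambda>j i. \<kappa> (Suc j) (Suc i))"
  \<comment> \<open>One more than the previously chosen index, so that the sum over i < m j includes
    the term k (j - 1) itself.\<close>
  define m where "m j = (case j of 0 \<Rightarrow> 0 | Suc i \<Rightarrow> Suc (k i))" for j
  have k: "k j = \<kappa> j (m j)" for j by (cases j) (simp_all add: k_def m_def)
  define U where "U j = (4::real) ^ j *\<^sub>R (\<Sum>i<m j. a i)" for j
  have big: "e < norm (T (pprt (a (k j) - U j)))" for j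
    using \<kappa>[of j "m j"] by (simp add: k U_def)
  have below_U: "(4::real) ^ j *\<^sub>R a i \<le> U j" if "i < m j" for i j
    unfolding U_def using sum_mono2[of "{..<m j}" "{i}" a] that a0 by (intro scaleR_left_mono) simp_all
  \<comment> \<open>A new index below m j would be one of the summands; then U j would dominate a (k
    j) and the remainder would be 0.\<close>
  have mk: "m j \<le> k j" for j
  proof (rule ccontr)
    assume "\<not> m j \<le> k j"
    then have "(4::real) ^ j *\<^sub>R a (k j) \<le> U j" by (intro below_U) simp
    moreover have "1 *\<^sub>R a (k j) \<le> (4::real) ^ j *\<^sub>R a (k j)" by (intro scaleR_right_mono a0) simp
    ultimately have "a (k j) - U j \<le> 0" by simp
    then show False using big[of j] e by (simp add: linear_0[OF linT])
  qed
  have "strict_mono k"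
    unfolding strict_mono_Suc_iff
  proof
    fix j show "k j < k (Suc j)" using mk[of "Suc j"] by (simp add: m_def)
  qed
  then have km: "k i < m j" if "i < j" for i j
    using that by (cases j) (auto simp: m_def less_Suc_eq_le strict_mono_less_eq)
  define b where "b j = a (k j)" for j
  have b0: "0 \<le> b j" for j by (simp add: b_def a0)
  obtain K where K: "\<And>n. norm (x n) \<le> K" using bnd by (auto simp: bounded_iff)
  have sumb: "summable (\<lambda>j. (1/2::real) ^ j *\<^sub>R b j)"
  proof (rule summable_comparison_test')
    have "norm (b n) \<le> K" for n
      using norm_pprt_le[of "x (k n)"] K[of "k n"] unfolding b_def a_def by linarith
    then show "norm ((1/2::real) ^ n *\<^sub>R b n) \<le> (1/2) ^ n * K" for n
      by (simp add: mult_left_mono)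
    show "summable (\<lambda>n. (1/2::real) ^ n * K)" by (intro summable_mult2 summable_geometric) simp
  qed
  define z where "z = (\<Sum>j. (1/2::real) ^ j *\<^sub>R b j)"
  have bz: "(1/2::real) ^ j *\<^sub>R b j \<le> z" for j
  proof (rule tendsto_le_banach_lattice[OF tendsto_const summable_LIMSEQ[OF sumb, folded z_def]])
    have "(1/2::real) ^ j *\<^sub>R b j \<le> (\<Sum>i<n. (1/2::real) ^ i *\<^sub>R b i)" if "j < n" for n
      using sum_mono2[of "{..<n}" "{j}" "\<lambda>i. (1/2::real) ^ i *\<^sub>R b i"] that b0
      by (simp add: scaleR_nonneg_nonneg)
    then show "\<forall>\<^sub>F n in sequentially. (1/2::real) ^ j *\<^sub>R b j \<le> (\<Sum>i<n. (1/2::real) ^ i *\<^sub>R b i)"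
      by (rule eventually_mono[OF eventually_gt_at_top[of j]])
  qed simp
  have z0: "0 \<le> z" using bz[of 0] b0[of 0] by simp
  have U0: "0 \<le> U j" for j unfolding U_def by (intro scaleR_nonneg_nonneg sum_nonneg a0) simp
  \<comment> \<open>For i < j, U j in w j removes 4^j b i, while 2^-i z in w i removes 2^-i 2^-j b
    j. The product of the two factors is at least 1, the condition of
    \<open>lat_disj_pprt_scaleR\<close>; this is where the base 4 comes from.\<close>
  define w where "w j = pprt (b j - U j - (1/2::real) ^ j *\<^sub>R z)" for j
  have zj: "0 \<le> (1/2::real) ^ j *\<^sub>R z" for j by (intro scaleR_nonneg_nonneg z0) simp
  have disj_w: "lat_disj (w i) (w j)" if ij: "i < j" for i j
  proof -
    have "b j - U j - (1/2::real) ^ j *\<^sub>R z \<le> b j - (4::real) ^ j *\<^sub>R b i"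
      using below_U[OF km[OF ij]] zj[of j] unfolding b_def by (simp add: algebra_simps add_increasing2)
    then have 1: "w j \<le> pprt (b j - (4::real) ^ j *\<^sub>R b i)" unfolding w_def by (rule pprt_mono)
    have "(1/2::real) ^ i *\<^sub>R (1/2::real) ^ j *\<^sub>R b j \<le> (1/2::real) ^ i *\<^sub>R z"
      by (intro scaleR_left_mono bz) simp
    then have "b i - U i - (1/2::real) ^ i *\<^sub>R z \<le> b i - ((1/2::real) ^ i * (1/2) ^ j) *\<^sub>R b j"
      using U0[of i] by (simp add: algebra_simps add_increasing)
    then have 2: "w i \<le> pprt (b i - ((1/2::real) ^ i * (1/2) ^ j) *\<^sub>R b j)"
      unfolding w_def by (rule pprt_mono)
    have "(2::real) ^ i \<le> 2 ^ j" using ij by (intro power_increasing) simp_all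
    then have "(2::real) ^ i * 2 ^ j \<le> 2 ^ j * 2 ^ j" by (intro mult_right_mono) simp_all
    also have "\<dots> = 4 ^ j" by (simp flip: power_mult_distrib)
    finally have "1 \<le> (4::real) ^ j * ((1/2) ^ i * (1/2) ^ j)"
      by (simp add: field_simps power_divide)
    then have "lat_disj (pprt (b j - (4::real) ^ j *\<^sub>R b i)) (pprt (b i - ((1/2::real) ^ i * (1/2) ^ j) *\<^sub>R b j))"
      by (intro lat_disj_pprt_scaleR b0) simp_all
    then have "lat_disj (w j) (w i)" by (rule lat_disj_le2I) (use 1 2 in \<open>simp_all add: w_def\<close>)
    then show ?thesis by (simp add: lat_disj_commute)
  qed
  have "(\<lambda>j. T (w j)) \<longlonglongrightarrow> 0"
  proof (rule disjoint_dominated_null[OF ppp oc T, where y = "\<lambda>j. x (k j)"])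
    show "bounded (range (\<lambda>j. x (k j)))" using bnd by (rule bounded_subset) auto
    show "(\<lambda>n. T (P (x (k n)))) \<longlonglongrightarrow> 0" if "central P" for P
      using LIMSEQ_subseq_LIMSEQ[OF null[OF that] \<open>strict_mono k\<close>] by (simp add: o_def)
    show "0 \<le> w n" for n by (simp add: w_def)
    show "w n \<le> pprt (x (k n))" for n
    proof -
      have "b n - U n - (1/2::real) ^ n *\<^sub>R z \<le> b n"
        using U0[of n] zj[of n] by (simp add: algebra_simps add_increasing)
      then show ?thesis using b0[of n] unfolding w_def b_def a_def by (simp add: pprt_def)
    qed
    show "lat_disj (w i) (w j)" if "i \<noteq> j" for i j
      using that disj_w[of i j] disj_w[of j i] lat_disj_commute by (cases "i < j") auto
  qed
  moreover have "(\<lambda>j. (1/2::real) ^ j *\<^sub>R T z) \<longlonglongrightarrow> 0"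
  proof -
    have "(\<lambda>j. (1/2::real) ^ j) \<longlonglongrightarrow> 0" by (rule LIMSEQ_realpow_zero) auto
    from tendsto_scaleR[OF this tendsto_const] show ?thesis by simp
  qed
  ultimately have "(\<lambda>j. T (w j) + (1/2::real) ^ j *\<^sub>R T z) \<longlonglongrightarrow> 0 + 0" by (rule tendsto_add)
  then obtain j where j: "norm (T (w j) + (1/2::real) ^ j *\<^sub>R T z) < e"
    using LIMSEQ_D[of _ 0 e] e by fastforce
  have "b j - U j \<le> w j + (1/2::real) ^ j *\<^sub>R z"
    unfolding w_def by (simp add: pprt_def add_sup_distrib_right)
  moreover have "0 \<le> w j + (1/2::real) ^ j *\<^sub>R z" using zj by (simp add: w_def add_nonneg_nonneg)
  ultimately have "pprt (b j - U j) \<le> w j + (1/2::real) ^ j *\<^sub>R z" by (simp add: pprt_def[of "b j - U j"])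
  then have "T (pprt (b j - U j)) \<le> T (w j) + (1/2::real) ^ j *\<^sub>R T z"
    using positive_mono[OF T] by (metis linear_add[OF linT] linear_scale[OF linT])
  then have "norm (T (pprt (b j - U j))) < e"
    using norm_mono_nonneg j T by (metis order_le_less_trans positive_operator_def zero_le_pprt)
  then show False using big[of j] by (simp add: b_def)
qed

section \<open>Approximation of dominated operators\<close>

text \<open>A cell \<open>(P, B)\<close> plays the role of a measurable rectangle: an operator \<open>U\<close> is represented by
  the additive set function \<open>(P, B) \<mapsto> \<phi> (B (U (P u)))\<close>.\<close>

definition cell_cover ::
    "(('a::banach_lattice \<Rightarrow> 'a) \<times> ('b::banach_lattice \<Rightarrow> 'b)) list \<Rightarrow> bool" where
  "cell_cover cs \<longleftrightarrow> (\<forall>(P, B)\<in>set cs. central P \<and> central B) \<and>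
     (\<forall>U x. linear U \<longrightarrow> (\<Sum>(P, B)\<leftarrow>cs. B (U (P x))) = (U x :: 'b))"

text \<open>The order of composition makes a refined cell test the operator B U P on a cell (Q, C)
  of ds. Lists keep multiplicities, should refined cells coincide.\<close>

definition refine_cells ::
    "(('a \<Rightarrow> 'a) \<times> ('b \<Rightarrow> 'b)) list \<Rightarrow> (('a \<Rightarrow> 'a) \<times> ('b \<Rightarrow> 'b)) list \<Rightarrow> (('a \<Rightarrow> 'a) \<times> ('b \<Rightarrow> 'b)) list" where
  "refine_cells cs ds = concat (map (\<lambda>(P, B). map (\<lambda>(Q, C). (P \<circ> Q, C \<circ> B)) ds) cs)"

lemma sum_list_concat_map:
  "(\<Sum>x\<leftarrow>concat (map h xs). g x) = (\<Sum>x\<leftarrow>xs. \<Sum>y\<leftarrow>h x. g y)"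
  for g :: "'c \<Rightarrow> 'd::comm_monoid_add"
  by (induction xs) simp_all

lemma sum_list_swap:
  "(\<Sum>x\<leftarrow>xs. \<Sum>y\<leftarrow>ys. g x y) = (\<Sum>y\<leftarrow>ys. \<Sum>x\<leftarrow>xs. g x y)"
  for g :: "'c \<Rightarrow> 'd \<Rightarrow> 'e::comm_monoid_add"
  by (induction xs) (simp_all add: sum_list_addf)

lemma sum_list_refine_cells:
  "(\<Sum>c\<leftarrow>refine_cells cs ds. g c) = (\<Sum>(P, B)\<leftarrow>cs. \<Sum>(Q, C)\<leftarrow>ds. g (P \<circ> Q, C \<circ> B))"
  for g :: "_ \<Rightarrow> 'd::comm_monoid_add"
  by (simp add: refine_cells_def sum_list_concat_map case_prod_unfold o_def)

lemma linear_sum_list: "linear f \<Longrightarrow> f (\<Sum>c\<leftarrow>cs. g c) = (\<Sum>c\<leftarrow>cs. f (g c))"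
  by (induction cs) (simp_all add: linear_0 linear_add)

lemma cell_coverD:
  assumes "cell_cover cs"
  shows "(P, B) \<in> set cs \<Longrightarrow> central P" "(P, B) \<in> set cs \<Longrightarrow> central B"
    and "linear U \<Longrightarrow> (\<Sum>(P, B)\<leftarrow>cs. B (U (P x))) = U x"
  using assms by (auto simp: cell_cover_def)

text \<open>The cover identity holds for every linear operator, so that of ds may be applied to B U
  P inside each cell (P, B) of cs.\<close>

lemma cell_cover_refine:
  assumes cs: "cell_cover cs" and ds: "cell_cover ds"
  shows "cell_cover (refine_cells cs ds)"
  unfolding cell_cover_def
proof (intro conjI allI impI)
  show "\<forall>(P, B)\<in>set (refine_cells cs ds). central P \<and> central B"
  proof clarify
    fix P B assume "(P, B) \<in> set (refine_cells cs ds)"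
    then obtain P' B' Q C where "(P', B') \<in> set cs" "(Q, C) \<in> set ds" 
        "P = (\<lambda>x. P' (Q x))" "B = (\<lambda>x. C (B' x))"
      unfolding refine_cells_def by (auto simp: o_def)
    then show "central P \<and> central B"
      using central_comp[unfolded o_def, of P' Q] central_comp[unfolded o_def, of C B'] cell_coverD(1,2)[OF cs] cell_coverD(1,2)[OF ds]
      by blast
  qed
  fix U :: "'a \<Rightarrow> 'b" and x assume U: "linear U"
  have "(\<Sum>(P, B)\<leftarrow>refine_cells cs ds. B (U (P x))) =
      (\<Sum>(P, B)\<leftarrow>cs. \<Sum>(Q, C)\<leftarrow>ds. C (B (U (P (Q x)))))"
    using sum_list_refine_cells[where g = "\<lambda>(P, B). B (U (P x))"] by (simp add: o_def)
  also have "\<dots> = (\<Sum>(P, B)\<leftarrow>cs. B (U (P x)))"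
  proof (intro arg_cong[where f = sum_list] map_cong refl, clarify)
    fix P B assume "(P, B) \<in> set cs"
    then have "linear (\<lambda>x. B (U (P x)))"
      using U linear_compose[OF linear_compose[of P U] , of B]
      by (simp add: o_def central_linear cell_coverD[OF cs])
    from cell_coverD(3)[OF ds this]
    show "(\<Sum>(Q, C)\<leftarrow>ds. C (B (U (P (Q x))))) = B (U (P x))" .
  qed
  finally show "(\<Sum>(P, B)\<leftarrow>refine_cells cs ds. B (U (P x))) = U x"
    using cell_coverD(3)[OF cs U] by simp
qed

text \<open>The test cover of \<open>ex_approximation\<close>: M and its complement choose signs in
  the source, N and its complement choose signs in the target.\<close>

lemma cell_cover_four:
  assumes "central M" "central N"
  shows "cell_cover [(M, N), (M, \<lambda>y. y - N y), (\<lambda>x. x - M x, N), (\<lambda>x. x - M x, \<lambda>y. y - N y)]"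
  using assms unfolding cell_cover_def
  by (auto simp: central_compl linear_diff)

section \<open>Masses, energy and densities of cells\<close>

lemma variance_identity:
  fixes s t f :: real
  assumes "0 \<le> s" "s \<le> t"
  shows "(s - f * t)\<^sup>2 / t = s\<^sup>2 / t - 2 * f * s + f\<^sup>2 * t"
proof (cases "t = 0")
  case False
  then show ?thesis by (simp add: field_simps power2_eq_square)
qed (use assms in simp)

text \<open>Either |a| <= \<eta> t, or multiplying by |a| / (\<eta> t) > 1 only enlarges |a|. Summed
  over cells, this replaces the Cauchy-Schwarz inequality.\<close>

lemma abs_le_square_div:
  fixes a t \<eta> :: real
  assumes "0 \<le> t" "0 < \<eta>" "t = 0 \<Longrightarrow> a = 0"
  shows "\<bar>a\<bar> \<le> a\<^sup>2 / t / \<eta> + \<eta> * t"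
proof (cases "t = 0")
  case False
  then have t: "0 < \<eta> * t" using assms by simp
  show ?thesis
  proof (cases "\<bar>a\<bar> \<le> \<eta> * t")
    case True
    moreover have "0 \<le> a\<^sup>2 / t / \<eta>" using assms by simp
    ultimately show ?thesis by linarith
  next
    case large: False
    then have "\<bar>a\<bar> * (\<eta> * t) \<le> \<bar>a\<bar> * \<bar>a\<bar>" by (intro mult_left_mono) simp_all
    then have "\<bar>a\<bar> \<le> a\<^sup>2 / (\<eta> * t)" using t by (simp add: pos_le_divide_eq power2_eq_square)
    then show ?thesis using t by (simp add: mult.commute)
  qed
qed (use assms in simp)

context
  fixes S T :: "'a::banach_lattice \<Rightarrow> 'b::banach_lattice" and \<phi> :: "'b \<Rightarrow>\<^sub>L real" and u :: 'a
  assumes S: "positive_operator S" and T: "positive_operator T" and ST: "operator_le S T"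
    and \<phi>: "0 \<le> \<phi>" and u: "0 \<le> u"
begin

definition cell_mass :: "('a \<Rightarrow> 'b) \<Rightarrow> ('a \<Rightarrow> 'a) \<times> ('b \<Rightarrow> 'b) \<Rightarrow> real" where
  "cell_mass U = (\<lambda>(P, B). blinfun_apply \<phi> (B (U (P u))))"

text \<open>A discrete integral of the squared density of S with respect to T. A cell of T-mass 0
  has S-mass 0 as well and contributes 0 through division by zero.\<close>

definition cell_energy :: "(('a \<Rightarrow> 'a) \<times> ('b \<Rightarrow> 'b)) list \<Rightarrow> real" where
  "cell_energy cs = (\<Sum>c\<leftarrow>cs. (cell_mass S c)\<^sup>2 / cell_mass T c)"

definition cell_density :: "('a \<Rightarrow> 'a) \<times> ('b \<Rightarrow> 'b) \<Rightarrow> real" where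
  "cell_density c = cell_mass S c / cell_mass T c"

lemma linear_S: "linear S" and linear_T: "linear T"
  using S T by (simp_all add: positive_operator_def)

lemma mass_bounds:
  assumes "central P" "central B"
  shows "0 \<le> cell_mass S (P, B)" "cell_mass S (P, B) \<le> cell_mass T (P, B)"
proof -
  have Pu: "0 \<le> P u" by (rule central_nonneg[OF assms(1) u])
  have "0 \<le> S (P u)" using S Pu by (simp add: positive_operator_def)
  then show "0 \<le> cell_mass S (P, B)"
    unfolding cell_mass_def by (simp add: blinfun_nonneg[OF \<phi>] central_nonneg[OF assms(2)])
  have "S (P u) \<le> T (P u)" using ST Pu by (simp add: operator_le_def positive_operator_def)
  then show "cell_mass S (P, B) \<le> cell_mass T (P, B)"
    unfolding cell_mass_def
    by (simp add: blinfun_mono[OF \<phi>] positive_mono[OF central_positive[OF assms(2)]])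
qed

lemma density_bounds:
  assumes "central P" "central B"
  shows "0 \<le> cell_density (P, B)" "cell_density (P, B) \<le> 1"
  using mass_bounds[OF assms] by (auto simp: cell_density_def divide_le_eq_1)

lemma sum_mass:
  assumes "cell_cover cs" "linear U"
  shows "(\<Sum>c\<leftarrow>cs. cell_mass U c) = blinfun_apply \<phi> (U u)"
proof -
  have "linear (blinfun_apply \<phi>)" by (intro bounded_linear.linear blinfun.bounded_linear_right)
  then have "(\<Sum>c\<leftarrow>cs. cell_mass U c) = blinfun_apply \<phi> (\<Sum>(P, B)\<leftarrow>cs. B (U (P u)))"
    by (simp add: linear_sum_list cell_mass_def case_prod_unfold)
  then show ?thesis by (simp add: cell_coverD(3)[OF assms])
qed

lemma energy_le: assumes cs: "cell_cover cs" shows "cell_energy cs \<le> blinfun_apply \<phi> (S u)"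
proof -
  have "cell_energy cs \<le> (\<Sum>c\<leftarrow>cs. cell_mass S c)"
    unfolding cell_energy_def
  proof (rule sum_list_mono, clarify)
    fix P B assume "(P, B) \<in> set cs"
    then have c: "central P" "central B" by (simp_all add: cell_coverD[OF cs])
    have "(cell_mass S (P, B))\<^sup>2 / cell_mass T (P, B) = cell_mass S (P, B) * cell_density (P, B)"
      by (simp add: cell_density_def power2_eq_square)
    also have "\<dots> \<le> cell_mass S (P, B)"
      by (intro mult_left_le mass_bounds(1) density_bounds(2) c)
    finally show "(cell_mass S (P, B))\<^sup>2 / cell_mass T (P, B) \<le> cell_mass S (P, B)" .
  qed
  then show ?thesis by (simp add: sum_mass[OF cs linear_S])
qed

lemma sum_mass_refined:
  assumes ds: "cell_cover ds" and "central P" "central B" "linear U"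
  shows "(\<Sum>(Q, C)\<leftarrow>ds. cell_mass U (P \<circ> Q, C \<circ> B)) = cell_mass U (P, B)"
proof -
  have "linear (\<lambda>x. B (U (P x)))"
    using assms linear_compose[OF linear_compose[of P U], of B]
    by (simp add: o_def central_linear)
  from sum_mass[OF ds this] show ?thesis by (simp add: cell_mass_def case_prod_unfold)
qed

text \<open>Pythagoras: for the density f of a cell, the terms (s - f t)^2 / t of its subcells add
  up to exactly the energy gained by refining it. \<open>abs_le_square_div\<close> turns this
  quadratic deviation into an absolute one at the cost of \<eta> times the total T-mass.\<close>

lemma deviation_le_energy_gain:
  assumes cs: "cell_cover cs" and ds: "cell_cover ds" and \<eta>: "0 < \<eta>"
  shows "(\<Sum>(P, B)\<leftarrow>cs. \<Sum>(Q, C)\<leftarrow>ds.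
      \<bar>cell_mass S (P \<circ> Q, C \<circ> B) - cell_density (P, B) * cell_mass T (P \<circ> Q, C \<circ> B)\<bar>)
    \<le> (cell_energy (refine_cells cs ds) - cell_energy cs) / \<eta> + \<eta> * blinfun_apply \<phi> (T u)"
proof -
  define e where "e c = (cell_mass S c)\<^sup>2 / cell_mass T c" for c
  have *: "(\<Sum>(Q, C)\<leftarrow>ds. \<bar>cell_mass S (P \<circ> Q, C \<circ> B) - cell_density (P, B) * cell_mass T (P \<circ> Q, C \<circ> B)\<bar>)
      \<le> ((\<Sum>(Q, C)\<leftarrow>ds. e (P \<circ> Q, C \<circ> B)) - e (P, B)) / \<eta> + \<eta> * cell_mass T (P, B)"
    if "(P, B) \<in> set cs" for P B
  proof -
    define f where "f = cell_density (P, B)"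
    have c: "central P" "central B" using that by (simp_all add: cell_coverD[OF cs])
    have "(\<Sum>(Q, C)\<leftarrow>ds. \<bar>cell_mass S (P \<circ> Q, C \<circ> B) - f * cell_mass T (P \<circ> Q, C \<circ> B)\<bar>)
      \<le> (\<Sum>(Q, C)\<leftarrow>ds. e (P \<circ> Q, C \<circ> B) / \<eta> - (2 * f / \<eta>) * cell_mass S (P \<circ> Q, C \<circ> B)
            + (f\<^sup>2 / \<eta> + \<eta>) * cell_mass T (P \<circ> Q, C \<circ> B))"
    proof (rule sum_list_mono, clarify)
      fix Q C assume "(Q, C) \<in> set ds"
      then have "central (P \<circ> Q)" "central (C \<circ> B)"
        using c by (simp_all add: central_comp cell_coverD[OF ds])
      note b = mass_bounds[OF this]
      have "\<bar>cell_mass S (P \<circ> Q, C \<circ> B) - f * cell_mass T (P \<circ> Q, C \<circ> B)\<bar>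
        \<le> (cell_mass S (P \<circ> Q, C \<circ> B) - f * cell_mass T (P \<circ> Q, C \<circ> B))\<^sup>2 / cell_mass T (P \<circ> Q, C \<circ> B) / \<eta>
          + \<eta> * cell_mass T (P \<circ> Q, C \<circ> B)"
        by (rule abs_le_square_div) (use b \<eta> in auto)
      also have "\<dots> = e (P \<circ> Q, C \<circ> B) / \<eta> - (2 * f / \<eta>) * cell_mass S (P \<circ> Q, C \<circ> B)
            + (f\<^sup>2 / \<eta> + \<eta>) * cell_mass T (P \<circ> Q, C \<circ> B)"
        unfolding variance_identity[OF b] e_def using \<eta> by (simp add: field_simps)
      finally show "\<bar>cell_mass S (P \<circ> Q, C \<circ> B) - f * cell_mass T (P \<circ> Q, C \<circ> B)\<bar>
        \<le> e (P \<circ> Q, C \<circ> B) / \<eta> - (2 * f / \<eta>) * cell_mass S (P \<circ> Q, C \<circ> B)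
            + (f\<^sup>2 / \<eta> + \<eta>) * cell_mass T (P \<circ> Q, C \<circ> B)" .
    qed
    also have "\<dots> = (\<Sum>(Q, C)\<leftarrow>ds. e (P \<circ> Q, C \<circ> B)) / \<eta>
        - (2 * f / \<eta>) * (\<Sum>(Q, C)\<leftarrow>ds. cell_mass S (P \<circ> Q, C \<circ> B))
        + (f\<^sup>2 / \<eta> + \<eta>) * (\<Sum>(Q, C)\<leftarrow>ds. cell_mass T (P \<circ> Q, C \<circ> B))"
      by (simp add: case_prod_unfold sum_list_addf sum_list_subtractf sum_list_const_mult
          divide_inverse sum_list_mult_const)
    also have "\<dots> = (\<Sum>(Q, C)\<leftarrow>ds. e (P \<circ> Q, C \<circ> B)) / \<eta>
        - (2 * f / \<eta>) * cell_mass S (P, B) + (f\<^sup>2 / \<eta> + \<eta>) * cell_mass T (P, B)"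
      by (simp add: sum_mass_refined[OF ds c] linear_S linear_T)
    also have "\<dots> = ((\<Sum>(Q, C)\<leftarrow>ds. e (P \<circ> Q, C \<circ> B)) - e (P, B)) / \<eta> + \<eta> * cell_mass T (P, B)"
    proof -
      \<comment> \<open>On the unrefined cell the deviation is zero by the choice of f, which
        identifies - 2 f s + f^2 t with minus its energy.\<close>
      have "(cell_mass S (P, B) - f * cell_mass T (P, B))\<^sup>2 / cell_mass T (P, B) = 0"
        using mass_bounds[OF c] by (cases "cell_mass T (P, B) = 0") (simp_all add: f_def cell_density_def)
      then have "- 2 * f * cell_mass S (P, B) + f\<^sup>2 * cell_mass T (P, B) = - e (P, B)"
        unfolding variance_identity[OF mass_bounds[OF c]] e_def by simp
      then have "(- 2 * f * cell_mass S (P, B) + f\<^sup>2 * cell_mass T (P, B)) / \<eta> = - e (P, B) / \<eta>" by simp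
      then show ?thesis by (simp add: diff_divide_distrib add_divide_distrib algebra_simps)
    qed
    finally show ?thesis by (simp add: f_def)
  qed
  have "(\<Sum>(P, B)\<leftarrow>cs. \<Sum>(Q, C)\<leftarrow>ds.
      \<bar>cell_mass S (P \<circ> Q, C \<circ> B) - cell_density (P, B) * cell_mass T (P \<circ> Q, C \<circ> B)\<bar>)
    \<le> (\<Sum>(P, B)\<leftarrow>cs. ((\<Sum>(Q, C)\<leftarrow>ds. e (P \<circ> Q, C \<circ> B)) - e (P, B)) / \<eta> + \<eta> * cell_mass T (P, B))"
    by (rule sum_list_mono) (use * in auto)
  also have "\<dots> = ((\<Sum>(P, B)\<leftarrow>cs. \<Sum>(Q, C)\<leftarrow>ds. e (P \<circ> Q, C \<circ> B)) - (\<Sum>c\<leftarrow>cs. e c)) / \<eta>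
      + \<eta> * (\<Sum>c\<leftarrow>cs. cell_mass T c)"
    by (simp add: case_prod_unfold sum_list_addf sum_list_subtractf sum_list_const_mult
        divide_inverse sum_list_mult_const)
  finally show ?thesis
    unfolding cell_energy_def
    by (simp add: sum_mass[OF cs linear_T] sum_list_refine_cells flip: e_def)
qed

text \<open>A cover whose energy is nearly maximal has a density that is nearly optimal on every
  refinement.\<close>

lemma ex_good_cover:
  assumes \<epsilon>: "0 < \<epsilon>"
  obtains cs where "cell_cover cs"
    "\<And>ds. cell_cover ds \<Longrightarrow> (\<Sum>(P, B)\<leftarrow>cs. \<Sum>(Q, C)\<leftarrow>ds.
      \<bar>cell_mass S (P \<circ> Q, C \<circ> B) - cell_density (P, B) * cell_mass T (P \<circ> Q, C \<circ> B)\<bar>) \<le> \<epsilon>"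
proof -
  define t where "t = blinfun_apply \<phi> (T u)"
  have t: "0 \<le> t" using T u blinfun_nonneg[OF \<phi>] by (simp add: t_def positive_operator_def)
  \<comment> \<open>A cover within \<eta>^2 of the supremum gains at most \<eta>^2 under refinement,
    so the deviation is at most \<eta>^2 / \<eta> + \<eta> t = \<epsilon>.\<close>
  define \<eta> where "\<eta> = \<epsilon> / (1 + t)"
  have \<eta>: "0 < \<eta>" using \<epsilon> t by (simp add: \<eta>_def)
  define X where "X = cell_energy ` {cs. cell_cover cs}"
  have "cell_cover [(\<lambda>x. x, \<lambda>y. y)]"
    by (simp add: cell_cover_def central_def linear_ident)
  then have ne: "X \<noteq> {}" by (auto simp: X_def)
  have bdd: "bdd_above X" unfolding X_def by (rule bdd_aboveI2[OF energy_le]) simp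
  have "Sup X - \<eta>\<^sup>2 < Sup X" using \<eta> by simp
  then obtain z where "z \<in> X" "Sup X - \<eta>\<^sup>2 < z"
    using less_cSup_iff[OF ne bdd] by blast
  then obtain cs where cs: "cell_cover cs" "Sup X - \<eta>\<^sup>2 < cell_energy cs"
    unfolding X_def by blast
  show ?thesis
  proof
    fix ds :: "(('a \<Rightarrow> 'a) \<times> ('b \<Rightarrow> 'b)) list" assume ds: "cell_cover ds"
    have "cell_energy (refine_cells cs ds) \<le> Sup X"
      by (rule cSup_upper[OF _ bdd]) (simp add: X_def cell_cover_refine[OF cs(1) ds])
    then have "(cell_energy (refine_cells cs ds) - cell_energy cs) / \<eta> \<le> \<eta>\<^sup>2 / \<eta>"
      using cs(2) \<eta> by (intro divide_right_mono) simp_all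
    also have "\<eta>\<^sup>2 / \<eta> = \<eta>" by (simp add: power2_eq_square)
    finally have "(cell_energy (refine_cells cs ds) - cell_energy cs) / \<eta> + \<eta> * t \<le> \<eta> + \<eta> * t" by simp
    also have "\<eta> + \<eta> * t = \<eta> * (1 + t)" by (simp add: algebra_simps)
    also have "\<eta> * (1 + t) = \<epsilon>" using t by (simp add: \<eta>_def)
    finally show "(\<Sum>(P, B)\<leftarrow>cs. \<Sum>(Q, C)\<leftarrow>ds.
      \<bar>cell_mass S (P \<circ> Q, C \<circ> B) - cell_density (P, B) * cell_mass T (P \<circ> Q, C \<circ> B)\<bar>) \<le> \<epsilon>"
      using deviation_le_energy_gain[OF cs(1) ds \<eta>] by (simp add: t_def)
  qed (rule cs)
qed

text \<open>R replaces S on each cell by density times T. Uniformity on [-u, u] holds because cs is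
  fixed before z: by Freudenthal z is close to M u - (u - M u), and each such sign pattern is tested
  by a refinement of cs with only four cells.\<close>

lemma ex_approximation:
  assumes pppa: "principal_projection_property TYPE('a)" and pppb: "principal_projection_property TYPE('b)" and Tb: "bounded_linear T"
    and \<epsilon>: "0 < \<epsilon>"
  obtains R where "linear R" "\<And>v. \<bar>R v\<bar> \<le> T \<bar>v\<bar>"
    "\<And>x :: nat \<Rightarrow> 'a. (\<And>P. central P \<Longrightarrow> (\<lambda>n. T (P (x n))) \<longlonglongrightarrow> 0) \<Longrightarrow> (\<lambda>n. R (x n)) \<longlonglongrightarrow> 0"
    "\<And>z. \<bar>z\<bar> \<le> u \<Longrightarrow> blinfun_apply \<phi> \<bar>S z - R z\<bar> \<le> \<epsilon>"
proof -
  obtain cs where cs: "cell_cover cs"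
    "\<And>ds. cell_cover ds \<Longrightarrow> (\<Sum>(P, B)\<leftarrow>cs. \<Sum>(Q, C)\<leftarrow>ds.
      \<bar>cell_mass S (P \<circ> Q, C \<circ> B) - cell_density (P, B) * cell_mass T (P \<circ> Q, C \<circ> B)\<bar>) \<le> \<epsilon> / 2"
    using ex_good_cover[of "\<epsilon> / 2"] \<epsilon> by auto
  define R where "R v = (\<Sum>(P, B)\<leftarrow>cs. cell_density (P, B) *\<^sub>R B (T (P v)))" for v
  have cell_lin: "linear (\<lambda>v. B (T (P v)))" if "(P, B) \<in> set cs" for P B
    using that linear_T linear_compose[OF linear_compose[of P T], of B]
    by (simp add: o_def central_linear cell_coverD[OF cs(1)])
  have linR: "linear R"
  proof
    fix v w :: 'a and r :: real
    have "R (v + w) = (\<Sum>(P, B)\<leftarrow>cs. cell_density (P, B) *\<^sub>R B (T (P v)) + cell_density (P, B) *\<^sub>R B (T (P w)))"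
      unfolding R_def
      by (intro arg_cong[where f = sum_list] map_cong refl)
        (auto simp: linear_add[OF cell_lin] scaleR_right_distrib)
    then show "R (v + w) = R v + R w" by (simp add: R_def case_prod_unfold sum_list_addf)
    have "R (r *\<^sub>R v) = (\<Sum>(P, B)\<leftarrow>cs. r *\<^sub>R cell_density (P, B) *\<^sub>R B (T (P v)))"
      unfolding R_def
      by (intro arg_cong[where f = sum_list] map_cong refl)
        (auto simp: linear_scale[OF cell_lin])
    then show "R (r *\<^sub>R v) = r *\<^sub>R R v"
      by (simp only: R_def case_prod_unfold linear_sum_list[OF linear_scaleR[of r]])
  qed
  have cell_nonneg: "0 \<le> B (T (P v))" if "(P, B) \<in> set cs" "0 \<le> v" for P B v
    using that T by (simp add: positive_operator_def central_nonneg cell_coverD[OF cs(1)])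
  have R_nonneg: "0 \<le> R v" if "0 \<le> v" for v
    unfolding R_def
  proof (rule sum_list_nonneg, clarsimp)
    fix P B assume c: "(P, B) \<in> set cs"
    then show "0 \<le> cell_density (P, B) *\<^sub>R B (T (P v))"
      by (intro scaleR_nonneg_nonneg density_bounds cell_nonneg[OF c that])
        (simp_all add: cell_coverD[OF cs(1)])
  qed
  then have posR: "positive_operator R" using linR by (simp add: positive_operator_def)
  have R_le: "R v \<le> T v" if "0 \<le> v" for v
  proof -
    have "R v \<le> (\<Sum>(P, B)\<leftarrow>cs. B (T (P v)))"
      unfolding R_def
    proof (rule sum_list_mono, clarify)
      fix P B assume c: "(P, B) \<in> set cs"
      have "cell_density (P, B) *\<^sub>R B (T (P v)) \<le> 1 *\<^sub>R B (T (P v))"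
        by (intro scaleR_right_mono density_bounds cell_nonneg[OF c that])
          (use c in \<open>simp_all add: cell_coverD[OF cs(1)]\<close>)
      then show "cell_density (P, B) *\<^sub>R B (T (P v)) \<le> B (T (P v))" by simp
    qed
    then show ?thesis by (simp add: cell_coverD(3)[OF cs(1) linear_T])
  qed
  have abs_R: "\<bar>R v\<bar> \<le> T \<bar>v\<bar>" for v
    using positive_abs[OF posR order_refl, of v] R_le[of "\<bar>v\<bar>"] by simp
  have R_null: "(\<lambda>n. R (x n)) \<longlonglongrightarrow> 0" if null: "\<And>P. central P \<Longrightarrow> (\<lambda>n. T (P (x n))) \<longlonglongrightarrow> 0" for x :: "nat \<Rightarrow> 'a"
  proof -
    have *: "(\<lambda>n. cell_density (P, B) *\<^sub>R B (T (P (x n)))) \<longlonglongrightarrow> 0" if c: "(P, B) \<in> set cs" for P B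
    proof -
      have cP: "central P" and cB: "central B" using c by (simp_all add: cell_coverD[OF cs(1)])
      have "(\<lambda>n. B (T (P (x n)))) \<longlonglongrightarrow> B 0"
        by (rule bounded_linear.tendsto[OF central_bounded_linear[OF cB]]) (rule null[OF cP])
      then have "(\<lambda>n. B (T (P (x n)))) \<longlonglongrightarrow> 0" by (simp add: linear_0[OF central_linear[OF cB]])
      from tendsto_scaleR[OF tendsto_const this] show ?thesis by simp
    qed
    have "(\<lambda>n. \<Sum>(P, B)\<leftarrow>ds. cell_density (P, B) *\<^sub>R B (T (P (x n)))) \<longlonglongrightarrow> 0" if "set ds \<subseteq> set cs" for ds
      using that
    proof (induction ds)
      case (Cons c ds)
      obtain P B where c: "c = (P, B)" by (cases c)
      have "(\<lambda>n. cell_density (P, B) *\<^sub>R B (T (P (x n))) + (\<Sum>(P, B)\<leftarrow>ds. cell_density (P, B) *\<^sub>R B (T (P (x n)))))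
          \<longlonglongrightarrow> 0 + 0"
        by (rule tendsto_add[OF * Cons.IH]) (use Cons.prems c in auto)
      then show ?case by (simp add: c)
    qed simp
    then show ?thesis by (simp add: R_def)
  qed
  define D where "D v = S v - R v" for v
  have linD: "linear D" unfolding D_def by (intro linear_compose_sub linear_S linR)
  have absD: "\<bar>D v\<bar> \<le> 2 *\<^sub>R T \<bar>v\<bar>" for v
  proof -
    have "\<bar>D v\<bar> \<le> \<bar>S v\<bar> + \<bar>R v\<bar>" unfolding D_def by (rule abs_triangle_ineq4)
    also have "\<bar>S v\<bar> \<le> S \<bar>v\<bar>" by (rule positive_abs[OF S order_refl])
    also have "S \<bar>v\<bar> \<le> T \<bar>v\<bar>" using ST by (simp add: operator_le_def positive_operator_def)
    also have "\<bar>R v\<bar> \<le> T \<bar>v\<bar>" by (rule abs_R)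
    finally show ?thesis by (simp add: scaleR_2)
  qed
  have step: "blinfun_apply \<phi> \<bar>D (M u - (u - M u))\<bar> \<le> \<epsilon> / 2" if M: "central M" for M
  proof -
    define y where "y = D (M u - (u - M u))"
    \<comment> \<open>N separates the signs of y, so that |y| = N y - (y - N y). Thus
      \<open>\<phi>\<close> of |y| becomes a signed sum over the four cells, bounded by the
      deviation of cs under ds.\<close>
    define N where "N = band_proj (pprt y)"
    have N: "central N" unfolding N_def by (rule central_band_proj[OF pppb]) simp
    have Ny: "N y = pprt y" unfolding N_def by (rule band_proj_pprt[OF pppb])
    define ds where "ds = [(M, N), (M, \<lambda>y. y - N y), (\<lambda>x. x - M x, N), (\<lambda>x. x - M x, \<lambda>y. y - N y)]"
    have ds: "cell_cover ds" unfolding ds_def by (rule cell_cover_four[OF M N])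
    have linphi: "linear (blinfun_apply \<phi>)" by (intro bounded_linear.linear blinfun.bounded_linear_right)
    have cell: "\<bar>blinfun_apply \<phi> (C (D (Q u)))\<bar> \<le>
      (\<Sum>(P, B)\<leftarrow>cs. \<bar>cell_mass S (P \<circ> Q, C \<circ> B) - cell_density (P, B) * cell_mass T (P \<circ> Q, C \<circ> B)\<bar>)" (is "_ \<le> ?r")
      if "(Q, C) \<in> set ds" for Q C
    proof -
      have C: "linear C" using that by (intro central_linear cell_coverD[OF ds])
      have "D (Q u) = (\<Sum>(P, B)\<leftarrow>cs. B (S (P (Q u)))) - R (Q u)"
        by (simp add: D_def cell_coverD(3)[OF cs(1) linear_S])
      also have "\<dots> = (\<Sum>(P, B)\<leftarrow>cs. B (S (P (Q u))) - cell_density (P, B) *\<^sub>R B (T (P (Q u))))"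
        by (simp add: R_def case_prod_unfold sum_list_subtractf)
      finally have eq: "blinfun_apply \<phi> (C (D (Q u))) =
          (\<Sum>(P, B)\<leftarrow>cs. cell_mass S (P \<circ> Q, C \<circ> B) - cell_density (P, B) * cell_mass T (P \<circ> Q, C \<circ> B))"
        by (simp add: linear_sum_list[OF C] linear_sum_list[OF linphi] case_prod_unfold
            linear_diff[OF C] linear_scale[OF C] linear_diff[OF linphi] linear_scale[OF linphi] cell_mass_def)
      show ?thesis
        unfolding eq using sum_list_abs[of "map (\<lambda>(P, B). cell_mass S (P \<circ> Q, C \<circ> B) - cell_density (P, B) * cell_mass T (P \<circ> Q, C \<circ> B)) cs"]
        by (simp add: o_def case_prod_unfold)
    qed
    have y: "y = D (M u) - D (u - M u)" unfolding y_def by (rule linear_diff[OF linD])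
    have "\<bar>y\<bar> = N y - (y - N y)"
      using pprt_decomp[of y] by (simp add: abs_pprt Ny algebra_simps)
    also have "\<dots> = N (D (M u)) - (D (M u) - N (D (M u))) - N (D (u - M u)) + (D (u - M u) - N (D (u - M u)))"
      unfolding y linear_diff[OF central_linear[OF N]] by (simp add: algebra_simps)
    finally have "blinfun_apply \<phi> \<bar>y\<bar> \<le> (\<Sum>(Q, C)\<leftarrow>ds. \<bar>blinfun_apply \<phi> (C (D (Q u)))\<bar>)"
      by (simp add: ds_def blinfun.diff_right blinfun.add_right)
    also have "\<dots> \<le> (\<Sum>(Q, C)\<leftarrow>ds. \<Sum>(P, B)\<leftarrow>cs.
        \<bar>cell_mass S (P \<circ> Q, C \<circ> B) - cell_density (P, B) * cell_mass T (P \<circ> Q, C \<circ> B)\<bar>)"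
      by (rule sum_list_mono) (use cell in auto)
    also have "\<dots> = (\<Sum>(P, B)\<leftarrow>cs. \<Sum>(Q, C)\<leftarrow>ds.
        \<bar>cell_mass S (P \<circ> Q, C \<circ> B) - cell_density (P, B) * cell_mass T (P \<circ> Q, C \<circ> B)\<bar>)"
      unfolding case_prod_unfold by (rule sum_list_swap)
    also have "\<dots> \<le> \<epsilon> / 2" by (rule cs(2)[OF ds])
    finally show ?thesis by (simp add: y_def)
  qed
  obtain K where K: "\<And>x. norm (T x) \<le> norm x * K" "0 < K" using bounded_linear.pos_bounded[OF Tb] by blast
  have approx: "blinfun_apply \<phi> \<bar>S z - R z\<bar> \<le> \<epsilon>" if z: "\<bar>z\<bar> \<le> u" for z
  proof -
    \<comment> \<open>Halving moves z from [-u, u] to [0, u], where \<open>freudenthal\<close>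
      applies; since z = 2 x - u, the error is doubled on the way back.\<close>
    define x where "x = (1/2) *\<^sub>R (z + u)"
    define c where "c = norm \<phi> + 1"
    have c: "0 < c" "norm \<phi> \<le> c" by (simp_all add: c_def add_nonneg_pos)
    \<comment> \<open>With |v| of norm at most 2 \<delta> and |D v| <= 2 T |v|, the error from v is
      at most 2 c (2 \<delta> K) = \<epsilon>/2. Taking c above the norm of \<open>\<phi>\<close>
      avoids division by 0.\<close>
    define \<delta> where "\<delta> = \<epsilon> / (8 * c * K)"
    have \<delta>: "0 < \<delta>" using \<epsilon> K c by (simp add: \<delta>_def)
    have zu: "z \<le> u" "- z \<le> u" using z abs_le_iff by auto
    have "0 \<le> z + u" using zu(2) by (metis add.commute add_left_mono add.right_inverse minus_minus)
    then have x0: "0 \<le> x" by (simp add: x_def scaleR_nonneg_nonneg)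
    have "(1/2) *\<^sub>R (z + u) \<le> (1/2) *\<^sub>R (u + u)" using zu(1) by (intro scaleR_left_mono add_right_mono) simp_all
    then have xu: "x \<le> u" by (simp add: x_def flip: scaleR_2)
    obtain M where M: "central M" "norm (M u - x) \<le> \<delta>" by (rule freudenthal[OF pppa x0 xu \<delta>])
    define v where "v = z - (M u - (u - M u))"
    have "v = (-2) *\<^sub>R (M u - x)" by (simp add: v_def x_def algebra_simps scaleR_2)
    then have nv: "norm v \<le> 2 * \<delta>" using M(2) by simp
    have "D z = D (M u - (u - M u)) + D v"
      unfolding v_def by (simp flip: linear_add[OF linD])
    then have "\<bar>D z\<bar> \<le> \<bar>D (M u - (u - M u))\<bar> + \<bar>D v\<bar>" by (simp only: abs_triangle_ineq)
    then have "\<bar>D z\<bar> \<le> \<bar>D (M u - (u - M u))\<bar> + 2 *\<^sub>R T \<bar>v\<bar>"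
      by (rule order_trans) (intro add_left_mono absD)
    from blinfun_mono[OF \<phi> this]
    have 1: "blinfun_apply \<phi> \<bar>D z\<bar> \<le> blinfun_apply \<phi> \<bar>D (M u - (u - M u))\<bar> + 2 * blinfun_apply \<phi> (T \<bar>v\<bar>)"
      by (simp add: blinfun.add_right blinfun.scaleR_right)
    have "norm (T \<bar>v\<bar>) \<le> norm v * K" using K(1)[of "\<bar>v\<bar>"] by (simp add: norm_abs)
    also have "\<dots> \<le> 2 * \<delta> * K" using nv K(2) by (intro mult_right_mono) simp_all
    finally have "norm \<phi> * norm (T \<bar>v\<bar>) \<le> c * (2 * \<delta> * K)"
      using c by (intro mult_mono) simp_all
    moreover have "c * (2 * \<delta> * K) = \<epsilon> / 4" using K(2) c by (simp add: \<delta>_def)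
    moreover have "blinfun_apply \<phi> (T \<bar>v\<bar>) \<le> norm \<phi> * norm (T \<bar>v\<bar>)"
      using norm_blinfun[of \<phi> "T \<bar>v\<bar>"] by simp
    ultimately have "blinfun_apply \<phi> \<bar>D z\<bar> \<le> \<epsilon>" using 1 step[OF M(1)] by linarith
    then show ?thesis by (simp add: D_def)
  qed
  show ?thesis by (rule that[OF linR abs_R R_null approx])
qed

end

section \<open>Domination\<close>

lemma diff_inf_eq_pprt: "a - inf a u = pprt (a - u)" for a u :: "'a::lattice_ab_group_add"
  by (simp add: diff_inf_eq_sup pprt_def add_sup_distrib_left sup_commute)

text \<open>The truncation is used twice. For weak convergence it places x n near [-u, u], where R
  approximates S; for norm convergence the same kind of truncation bounds |S (x n)| by S u up to a
  remainder below T (d n).\<close>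

lemma dominated_null:
  fixes S T :: "'a::banach_lattice \<Rightarrow> 'b::banach_lattice" and x :: "nat \<Rightarrow> 'a"
  assumes pppa: "principal_projection_property TYPE('a)" and oc: "order_continuous_norm TYPE('b)"
    and S: "positive_operator S" and T: "positive_operator T" and ST: "operator_le S T"
    and Tb: "bounded_linear T" and bnd: "bounded (range x)"
    and null: "\<And>P. central P \<Longrightarrow> (\<lambda>n. T (P (x n))) \<longlonglongrightarrow> 0"
  shows "(\<lambda>n. S (x n)) \<longlonglongrightarrow> 0"
proof -
  have linS: "linear S" and linT: "linear T" using S T by (simp_all add: positive_operator_def)
  have pppb: "principal_projection_property TYPE('b)" by (rule order_continuous_norm_principal_projection[OF oc])
  have S_le_T: "S v \<le> T v" if "0 \<le> v" for v
    using ST that by (simp add: operator_le_def positive_operator_def)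
  have truncate: "\<exists>u\<ge>0. \<exists>z d. (\<forall>n. \<bar>z n\<bar> \<le> u \<and> \<bar>x n - z n\<bar> \<le> d n \<and> norm (T (d n)) \<le> e)"
    if e: "0 < e" for e
  proof -
    have e2: "0 < e / 2" using e by simp
    obtain u1 where u1: "0 \<le> u1" "\<And>n. norm (T (pprt (pprt (x n) - u1))) \<le> e / 2"
      using almost_order_bounded[OF pppa oc T bnd null e2] by blast
    have bnd': "bounded (range (\<lambda>n. - x n))" using bnd by (auto simp: bounded_iff)
    have null': "(\<lambda>n. T (P (- x n))) \<longlonglongrightarrow> 0" if P: "central P" for P
      using tendsto_minus[OF null[OF P]]
      by (simp add: linear_neg[OF linT] linear_neg[OF central_linear[OF P]])
    obtain u2 where u2: "0 \<le> u2" "\<And>n. norm (T (pprt (pprt (- x n) - u2))) \<le> e / 2"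
      using almost_order_bounded[OF pppa oc T bnd' null' e2] by blast
    \<comment> \<open>One level for both signs: enlarging u only shrinks
      \<open>pprt (a - u)\<close>, so the bounds for u1 and u2 persist.\<close>
    define u where "u = u1 + u2"
    define z where "z n = inf (pprt (x n)) u - inf (pprt (- x n)) u" for n
    define d where "d n = pprt (pprt (x n) - u) + pprt (pprt (- x n) - u)" for n
    have u0: "0 \<le> u" using u1 u2 by (simp add: u_def)
    have "\<bar>z n\<bar> \<le> u" for n
    proof (rule abs_leI)
      have 1: "0 \<le> inf (pprt (x n)) u" "0 \<le> inf (pprt (- x n)) u" using u0 by simp_all
      have "inf (pprt (x n)) u \<le> u" "inf (pprt (- x n)) u \<le> u" by simp_all
      then show "z n \<le> u" "- z n \<le> u" using 1 unfolding z_def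
        by (simp_all add: diff_le_eq add_increasing2)
    qed
    moreover have "\<bar>x n - z n\<bar> \<le> d n" for n
    proof -
      have "x n - z n = (pprt (x n) - inf (pprt (x n)) u) - (pprt (- x n) - inf (pprt (- x n)) u)"
        using pprt_decomp[of "x n"] by (simp add: z_def algebra_simps)
      also have "\<dots> = pprt (pprt (x n) - u) - pprt (pprt (- x n) - u)"
        by (simp only: diff_inf_eq_pprt)
      finally show ?thesis
        using abs_triangle_ineq4[of "pprt (pprt (x n) - u)" "pprt (pprt (- x n) - u)"]
        by (simp add: d_def)
    qed
    moreover have "norm (T (d n)) \<le> e" for n
    proof -
      have "norm (T (pprt (a - u))) \<le> norm (T (pprt (a - v)))" if "v \<le> u" for a v
      proof (rule norm_mono_nonneg)
        show "0 \<le> T (pprt (a - u))" using T by (simp add: positive_operator_def)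
        show "T (pprt (a - u)) \<le> T (pprt (a - v))"
          using that by (intro positive_mono[OF T] pprt_mono diff_left_mono)
      qed
      from order_trans[OF this u1(2)] order_trans[OF this u2(2)]
      have "norm (T (pprt (pprt (x n) - u))) \<le> e / 2" "norm (T (pprt (pprt (- x n) - u))) \<le> e / 2"
        using u1(1) u2(1) by (simp_all add: u_def)
      then show ?thesis
        unfolding d_def linear_add[OF linT]
        using norm_triangle_ineq[of "T (pprt (pprt (x n) - u))" "T (pprt (pprt (- x n) - u))"] by simp
    qed
    ultimately show ?thesis using u0 by blast
  qed
  have weak: "(\<lambda>n. blinfun_apply \<phi> \<bar>S (x n)\<bar>) \<longlonglongrightarrow> 0" if \<phi>: "0 \<le> \<phi>" for \<phi> :: "'b \<Rightarrow>\<^sub>L real"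
  proof (rule LIMSEQ_I)
    fix \<epsilon> :: real assume \<epsilon>: "0 < \<epsilon>"
    define c where "c = norm \<phi> + 1"
    have c: "0 < c" "norm \<phi> \<le> c" by (simp_all add: c_def add_nonneg_pos)
    \<comment> \<open>The budget is \<epsilon>/8 for R (x n), \<epsilon>/4 for S - R at z n, and 2
      \<epsilon>/8 for S - R at x n - z n, where both operators lie below T (d n).\<close>
    define e where "e = \<epsilon> / (8 * c)"
    have e: "0 < e" using \<epsilon> c by (simp add: e_def)
    have e_le: "norm \<phi> * e \<le> \<epsilon> / 8"
    proof -
      have "norm \<phi> * e \<le> c * e" using e c by (intro mult_right_mono) simp_all
      also have "\<dots> = \<epsilon> / 8" using c by (simp add: e_def)
      finally show ?thesis .
    qed
    obtain u z d where u: "0 \<le> u" and z: "\<And>n. \<bar>z n\<bar> \<le> u"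
      and d: "\<And>n. \<bar>x n - z n\<bar> \<le> d n" "\<And>n. norm (T (d n)) \<le> e"
      using truncate[OF e] by blast
    have "0 < \<epsilon> / 4" using \<epsilon> by simp
    from ex_approximation[OF S T ST \<phi> u pppa pppb Tb this]
    obtain R where R: "linear R" "\<And>v. \<bar>R v\<bar> \<le> T \<bar>v\<bar>"
      "\<And>x :: nat \<Rightarrow> 'a. (\<And>P. central P \<Longrightarrow> (\<lambda>n. T (P (x n))) \<longlonglongrightarrow> 0) \<Longrightarrow> (\<lambda>n. R (x n)) \<longlonglongrightarrow> 0"
      "\<And>z. \<bar>z\<bar> \<le> u \<Longrightarrow> blinfun_apply \<phi> \<bar>S z - R z\<bar> \<le> \<epsilon> / 4" by blast
    have \<phi>_le: "blinfun_apply \<phi> v \<le> norm \<phi> * norm v" for v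
      using norm_blinfun[of \<phi> v] by simp
    have "(\<lambda>n. R (x n)) \<longlonglongrightarrow> 0" by (rule R(3)) (rule null)
    from LIMSEQ_D[OF this e] obtain m where m: "\<And>n. m \<le> n \<Longrightarrow> norm (R (x n)) < e" by auto
    have "norm (blinfun_apply \<phi> \<bar>S (x n)\<bar> - 0) < \<epsilon>" if n: "m \<le> n" for n
    proof -
      define v where "v = x n - z n"
      have v: "T \<bar>v\<bar> \<le> T (d n)" unfolding v_def by (rule positive_mono[OF T d(1)])
      have "S (x n) = R (x n) + (S (z n) - R (z n)) + (S v - R v)"
        by (simp add: v_def linear_diff[OF linS] linear_diff[OF R(1)])
      then have "\<bar>S (x n)\<bar> \<le> \<bar>R (x n) + (S (z n) - R (z n))\<bar> + \<bar>S v - R v\<bar>"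
        by (simp only: abs_triangle_ineq)
      moreover have "\<bar>R (x n) + (S (z n) - R (z n))\<bar> \<le> \<bar>R (x n)\<bar> + \<bar>S (z n) - R (z n)\<bar>"
        by (rule abs_triangle_ineq)
      moreover have "\<bar>S v - R v\<bar> \<le> T (d n) + T (d n)"
      proof -
        have "\<bar>S v\<bar> \<le> T (d n)"
          using positive_abs[OF S order_refl, of v] S_le_T[of "\<bar>v\<bar>"] v by simp
        moreover have "\<bar>R v\<bar> \<le> T (d n)" using R(2)[of v] v by (rule order_trans)
        ultimately have "\<bar>S v\<bar> + \<bar>R v\<bar> \<le> T (d n) + T (d n)" by (rule add_mono)
        with abs_triangle_ineq4 show ?thesis by (rule order_trans)
      qed
      ultimately have "\<bar>S (x n)\<bar> \<le> \<bar>R (x n)\<bar> + \<bar>S (z n) - R (z n)\<bar> + (T (d n) + T (d n))"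
        by (meson add_mono order_trans)
      from blinfun_mono[OF \<phi> this]
      have "blinfun_apply \<phi> \<bar>S (x n)\<bar> \<le> blinfun_apply \<phi> \<bar>R (x n)\<bar>
          + blinfun_apply \<phi> \<bar>S (z n) - R (z n)\<bar> + 2 * blinfun_apply \<phi> (T (d n))"
        by (simp add: blinfun.add_right)
      moreover have "blinfun_apply \<phi> \<bar>S (z n) - R (z n)\<bar> \<le> \<epsilon> / 4" by (rule R(4)[OF z])
      moreover have "blinfun_apply \<phi> \<bar>R (x n)\<bar> \<le> \<epsilon> / 8"
      proof -
        have "norm \<phi> * norm \<bar>R (x n)\<bar> \<le> norm \<phi> * e"
          using m[OF n] by (intro mult_left_mono) (simp_all add: norm_abs)
        then show ?thesis using \<phi>_le[of "\<bar>R (x n)\<bar>"] e_le by linarith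
      qed
      moreover have "blinfun_apply \<phi> (T (d n)) \<le> \<epsilon> / 8"
      proof -
        have "norm \<phi> * norm (T (d n)) \<le> norm \<phi> * e" by (intro mult_left_mono d(2)) simp
        then show ?thesis using \<phi>_le[of "T (d n)"] e_le by linarith
      qed
      moreover have "0 \<le> blinfun_apply \<phi> \<bar>S (x n)\<bar>" by (intro blinfun_nonneg[OF \<phi>]) simp
      ultimately show ?thesis using \<epsilon> by simp
    qed
    then show "\<exists>m. \<forall>n\<ge>m. norm (blinfun_apply \<phi> \<bar>S (x n)\<bar> - 0) < \<epsilon>" by blast
  qed
  show ?thesis
  proof (rule LIMSEQ_I)
    fix e :: real assume "0 < e"
    then have e: "0 < e / 2" by simp
    obtain u z d where u: "0 \<le> u" and z: "\<And>n. \<bar>z n\<bar> \<le> u"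
      and d: "\<And>n. \<bar>x n - z n\<bar> \<le> d n" "\<And>n. norm (T (d n)) \<le> e / 2"
      using truncate[OF e] by blast
    have Su: "0 \<le> S u" using S u by (simp add: positive_operator_def)
    \<comment> \<open>The order bounded part of |S (x n)|: it inherits weak convergence from |S (x
      n)|, and its upper bound S u lets weak convergence be upgraded to norm convergence.\<close>
    define y where "y n = inf \<bar>S (x n)\<bar> (S u)" for n
    have "y \<longlonglongrightarrow> 0"
    proof (rule order_continuous_norm_weak_to_norm[OF oc])
      show "0 \<le> y n" "y n \<le> S u" for n using Su by (simp_all add: y_def)
      fix \<phi> :: "'b \<Rightarrow>\<^sub>L real" assume \<phi>: "0 \<le> \<phi>"
      show "(\<lambda>n. blinfun_apply \<phi> (y n)) \<longlonglongrightarrow> 0"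
      proof (rule tendsto_sandwich[OF _ _ tendsto_const weak[OF \<phi>]])
        show "\<forall>\<^sub>F n in sequentially. 0 \<le> blinfun_apply \<phi> (y n)"
          using Su by (auto simp: y_def intro!: always_eventually blinfun_nonneg[OF \<phi>])
        show "\<forall>\<^sub>F n in sequentially. blinfun_apply \<phi> (y n) \<le> blinfun_apply \<phi> \<bar>S (x n)\<bar>"
          by (auto simp: y_def intro!: always_eventually blinfun_mono[OF \<phi>])
      qed
    qed
    then obtain m where m: "\<And>n. m \<le> n \<Longrightarrow> norm (y n) < e / 2"
      using LIMSEQ_D[of y 0, OF _ e] by auto
    have "norm (S (x n) - 0) < e" if "m \<le> n" for n
    proof -
      have d0: "0 \<le> d n" by (rule order_trans[OF abs_ge_zero d(1)])
      have "\<bar>x n\<bar> \<le> \<bar>z n\<bar> + \<bar>x n - z n\<bar>" using abs_triangle_ineq[of "z n" "x n - z n"] by simp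
      also have "\<dots> \<le> u + d n" by (intro add_mono z d(1))
      finally have "\<bar>S (x n)\<bar> \<le> S (u + d n)" by (rule positive_abs[OF S])
      also have "\<dots> \<le> S u + T (d n)" using S_le_T[OF d0] by (simp add: linear_add[OF linS])
      finally have "\<bar>S (x n)\<bar> - S u \<le> T (d n)" by (simp add: algebra_simps)
      moreover have "0 \<le> T (d n)" using T d0 by (simp add: positive_operator_def)
      ultimately have "pprt (\<bar>S (x n)\<bar> - S u) \<le> T (d n)" by (simp add: pprt_def)
      then have "\<bar>S (x n)\<bar> - y n \<le> T (d n)" by (simp add: y_def diff_inf_eq_pprt)
      then have "norm (\<bar>S (x n)\<bar> - y n) \<le> norm (T (d n))"
        by (intro norm_mono_nonneg) (simp_all add: y_def)
      then have "norm (\<bar>S (x n)\<bar> - y n) \<le> e / 2" using d(2)[of n] by linarith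
      then have "norm \<bar>S (x n)\<bar> < e"
        using m[OF that] norm_triangle_ineq[of "\<bar>S (x n)\<bar> - y n" "y n"] by simp
      then show ?thesis by (simp add: norm_abs)
    qed
    then show "\<exists>m. \<forall>n\<ge>m. norm (S (x n) - 0) < e" by blast
  qed
qed

section \<open>Central operators preserve almost limited sequences\<close>

text \<open>Whenever g <= u, positivity of P and P x <= x give g (P x) <= u (P x) <= u x for x >= 0.
  With g equal to f and - f, the modulus of f o P is bounded by that of f.\<close>

lemma dual_abs_comp_le:
  fixes f u :: "'a::banach_lattice \<Rightarrow>\<^sub>L real"
  assumes P: "central P" and u: "isLub UNIV {f, - f} u"
    and v: "isLub UNIV {f o\<^sub>L Blinfun P, - (f o\<^sub>L Blinfun P)} v"
  shows "0 \<le> v" "v \<le> u"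
proof -
  have abs_nonneg: "0 \<le> w" if "isLub UNIV {g, - g} w" for g w :: "'a \<Rightarrow>\<^sub>L real"
    unfolding less_eq_blinfun_def
  proof (intro allI impI)
    fix x :: 'a assume "0 \<le> x"
    moreover have "g \<le> w" "- g \<le> w" using isLubD2[OF that] by auto
    ultimately have "blinfun_apply g x \<le> blinfun_apply w x" "- blinfun_apply g x \<le> blinfun_apply w x"
      unfolding less_eq_blinfun_def by (auto simp: blinfun.minus_left)
    then show "blinfun_apply 0 x \<le> blinfun_apply w x" by simp
  qed
  show "0 \<le> v" by (rule abs_nonneg[OF v])
  have app: "blinfun_apply (Blinfun P) = P"
    by (rule bounded_linear_Blinfun_apply[OF central_bounded_linear[OF P]])
  have fu: "f \<le> u" "- f \<le> u" using isLubD2[OF u] by auto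
  show "v \<le> u"
  proof (rule isLub_le_isUb[OF v])
    have "g o\<^sub>L Blinfun P \<le> u" if "g \<le> u" for g
      unfolding less_eq_blinfun_def
    proof (intro allI impI)
      fix x :: 'a assume x: "0 \<le> x"
      have "blinfun_apply g (P x) \<le> blinfun_apply u (P x)"
        using that central_nonneg[OF P x] by (simp add: less_eq_blinfun_def)
      also have "\<dots> \<le> blinfun_apply u x"
        by (rule blinfun_mono[OF abs_nonneg[OF u] central_le[OF P x]])
      finally show "blinfun_apply (g o\<^sub>L Blinfun P) x \<le> blinfun_apply u x" by (simp add: app)
    qed
    from this[OF fu(1)] this[OF fu(2)]
    have "f o\<^sub>L Blinfun P \<le> u" "- (f o\<^sub>L Blinfun P) \<le> u"
      by (simp_all add: less_eq_blinfun_def blinfun.minus_left)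
    then show "isUb UNIV {f o\<^sub>L Blinfun P, - (f o\<^sub>L Blinfun P)} u"
      by (simp add: isUb_def setle_def)
  qed
qed

lemma dual_disjoint_comp_central:
  fixes f g :: "'a::banach_lattice \<Rightarrow>\<^sub>L real"
  assumes P: "central P" and fg: "dual_disjoint f g"
  shows "dual_disjoint (f o\<^sub>L Blinfun P) (g o\<^sub>L Blinfun P)"
proof -
  obtain u v where u: "isLub UNIV {f, - f} u" and v: "isLub UNIV {g, - g} v"
    and uv: "isGlb UNIV {u, v} 0"
    using fg by (auto simp: dual_disjoint_def)
  obtain u' v' where u': "isLub UNIV {f o\<^sub>L Blinfun P, - (f o\<^sub>L Blinfun P)} u'"
    and v': "isLub UNIV {g o\<^sub>L Blinfun P, - (g o\<^sub>L Blinfun P)} v'"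
    using ex_dual_sup by meson
  note le = dual_abs_comp_le[OF P u u'] dual_abs_comp_le[OF P v v']
  have "h \<le> 0" if "h \<le> u'" "h \<le> v'" for h
  proof -
    have "h \<le> u" "h \<le> v" using that le by (auto intro: order_trans)
    then show ?thesis
      using uv by (auto simp: isGlb_def greatestP_def isLb_def setle_def setge_def)
  qed
  then have "isGlb UNIV {u', v'} 0"
    using le by (auto simp: isGlb_def greatestP_def isLb_def setle_def setge_def)
  then show ?thesis using u' v' by (auto simp: dual_disjoint_def)
qed

lemma almost_limited_central:
  assumes P: "central P" and A: "almost_limited A"
  shows "almost_limited (P ` A)"
  unfolding almost_limited_def
proof (intro conjI allI impI)
  have app: "blinfun_apply (Blinfun P) = P"
    by (rule bounded_linear_Blinfun_apply[OF central_bounded_linear[OF P]])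
  show "bounded (P ` A)"
    using A by (intro bounded_linear_image central_bounded_linear[OF P]) (simp add: almost_limited_def)
  fix f :: "nat \<Rightarrow> 'a \<Rightarrow>\<^sub>L real" assume f: "disjoint_dual_seq f \<and> weak_star_null f"
  define g where "g n = f n o\<^sub>L Blinfun P" for n
  have "disjoint_dual_seq g"
    using f dual_disjoint_comp_central[OF P] by (auto simp: disjoint_dual_seq_def g_def)
  moreover have "weak_star_null g" using f by (simp add: weak_star_null_def g_def app)
  ultimately have "uniform_limit A (\<lambda>n x. blinfun_apply (g n) x) (\<lambda>x. 0) sequentially"
    using A by (simp add: almost_limited_def)
  then show "uniform_limit (P ` A) (\<lambda>n x. blinfun_apply (f n) x) (\<lambda>x. 0) sequentially"
    by (simp add: uniform_limit_iff g_def app)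
qed

lemma weakly_null_bounded_linear:
  assumes "bounded_linear P" "weakly_null x"
  shows "weakly_null (\<lambda>n. P (x n))"
  unfolding weakly_null_def
proof
  fix f :: "'b \<Rightarrow>\<^sub>L real"
  have "(\<lambda>n. blinfun_apply (f o\<^sub>L Blinfun P) (x n)) \<longlonglongrightarrow> 0"
    using assms(2) unfolding weakly_null_def by blast
  then show "(\<lambda>n. blinfun_apply f (P (x n))) \<longlonglongrightarrow> 0"
    by (simp add: bounded_linear_Blinfun_apply[OF assms(1)])
qed

theorem theorem3p14:
  fixes S T :: "'a::banach_lattice \<Rightarrow> 'b::banach_lattice"
  assumes "positive_operator S"
    and "positive_operator T"
    and "operator_le S T"
    and "alcc T"
    and "sigma_dedekind_complete TYPE('a)"
    and "order_continuous_norm TYPE('b)"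
  shows "alcc S"
proof -
  have Tb: "bounded_linear T" using assms(4) by (simp add: alcc_def)
  have "(\<lambda>n. S (x n)) \<longlonglongrightarrow> 0" if x: "almost_limited (range x)" "weakly_null x" for x
  \<comment> \<open>The hypothesis on T is applied to P (x n) for every central P, not just to x n
    itself.\<close>
  proof (rule dominated_null[OF _ assms(6,1-3) Tb])
    show "principal_projection_property TYPE('a)" by (rule sigma_dedekind_complete_principal_projection[OF assms(5)])
    show "bounded (range x)" using x by (simp add: almost_limited_def)
    fix P :: "'a \<Rightarrow> 'a" assume P: "central P"
    have "almost_limited (range (\<lambda>n. P (x n)))"
      using almost_limited_central[OF P x(1)] by (simp add: image_image)
    moreover have "weakly_null (\<lambda>n. P (x n))"
      by (rule weakly_null_bounded_linear[OF central_bounded_linear[OF P] x(2)])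
    ultimately have "(\<lambda>n. norm (T (P (x n)))) \<longlonglongrightarrow> 0" using assms(4) by (simp add: alcc_def)
    then show "(\<lambda>n. T (P (x n))) \<longlonglongrightarrow> 0" by (rule tendsto_norm_zero_cancel)
  qed
  then show ?thesis
    using positive_bounded_linear_mono[OF assms(1,3) Tb]
    by (auto simp: alcc_def intro: tendsto_norm_zero)
qed

end
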